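(* The following is a complete list of the four- and five-dimensional solvable real Lie subalgebras of $\mathfrak{sl}_3(\mathbb{R})$ up to conjugation in $\mathrm{SL}_3(\mathbb{R})$. Dimension 4: (1) $\mathfrak{u}_{4,1}=\langle X_\alpha,\,X_{\alpha+\beta},\,H_\alpha,\,H_\beta\rangle$; (2) $\mathfrak{u}_{4,2}=\langle X_\alpha,\,X_{\alpha+\beta},\,X_\beta-Y_\beta,\,2H_\alpha+H_\beta\rangle$; (3) $\mathfrak{u}_{4,3}=\langle X_\alpha,\,Y_\beta,\,H_\alpha,\,H_\beta\rangle$; (4) $\mathfrak{u}_{4,4}=\langle X_\alpha,\,Y_\beta,\,-X_{\alpha+\beta}+Y_{\alpha+\beta},\,H_\alpha-H_\beta\rangle$; (5) $\mathfrak{u}_{4,5}=\langle X_\alpha,\,X_\beta,\,X_{\alpha+\beta},\,H_\alpha+H_\beta\rangle$; (6) $\mathfrak{u}_{4,6}^a=\langle X_\alpha,\,X_\beta,\,X_{\alpha+\beta},\,aH_\alpha+H_\beta\rangle$, $a\in\mathbb{R}$, $a\neq\pm1$, where $\mathfrak{u}_{4,6}^a\sim\mathfrak{u}_{4,6}^b$ iff $a=b$; (7) $\mathfrak{u}_{4,7}=\langle X_\alpha,\,X_\beta,\,X_{\alpha+\beta},\,H_\alpha\rangle$; (8) $\mathfrak{u}_{4,8}=\langle X_\alpha,\,X_\beta,\,X_{\alpha+\beta},\,H_\alpha-H_\beta\rangle$. Dimension 5: (9) $\mathfrak{u}_{5,1}=\langle X_\alpha,\,X_\beta,\,X_{\alpha+\beta},\,H_\alpha,\,H_\beta\rangle$.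 That is, every solvable real subalgebra of $\mathfrak{sl}_3(\mathbb{R})$ of dimension four or five is conjugate under $\mathrm{SL}_3(\mathbb{R})$ to a subalgebra in this list, and distinct entries of the list (including distinct parameter values in (6)) are non-conjugate under $\mathrm{SL}_3(\mathbb{R})$.
   Context: $\mathfrak{sl}_3(\mathbb{R})$ is the Lie algebra of traceless real $3\times3$ matrices and $\mathrm{SL}_3(\mathbb{R})$ acts on its subalgebras by $g\cdot\mathfrak{u}=g\mathfrak{u}g^{-1}$; $\mathfrak{u}\sim\mathfrak{v}$ means that $\mathfrak{u}$ and $\mathfrak{v}$ lie in the same orbit of this action. With $E_{ij}$ the matrix units, the basis of $\mathfrak{sl}_3(\mathbb{R})$ used is $H_\alpha=E_{11}-E_{22}$, $H_\beta=E_{22}-E_{33}$, $X_\alpha=E_{12}$, $X_\beta=E_{23}$, $X_{\alpha+\beta}=-E_{13}$, $Y_\alpha=E_{21}$, $Y_\beta=E_{32}$, $Y_{\alpha+\beta}=-E_{31}$. $\langle\cdots\rangle$ denotes the real linear span. *)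

theory Defs
  imports "HOL-Analysis.Analysis"
begin

definition sl :: "(real^'n^'n) set" where
  "sl = {A. trace A = 0}"

definition SL :: "(real^'n^'n) set" where
  "SL = {g. det g = 1}"

definition lie_bracket :: "real^'n^'n \<Rightarrow> real^'n^'n \<Rightarrow> real^'n^'n" where
  "lie_bracket A B = A ** B - B ** A"

definition sl_subalgebra :: "(real^'n^'n) set \<Rightarrow> bool" where
  "sl_subalgebra u \<longleftrightarrow>
     u \<subseteq> sl \<and> subspace u \<and> (\<forall>A\<in>u. \<forall>B\<in>u. lie_bracket A B \<in> u)"

definition derived_algebra :: "(real^'n^'n) set \<Rightarrow> (real^'n^'n) set" where
  "derived_algebra u = span {lie_bracket A B | A B. A \<in> u \<and> B \<in> u}"

definition lie_solvable :: "(real^'n^'n) set \<Rightarrow> bool" where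
  "lie_solvable u \<longleftrightarrow> (\<exists>k. (derived_algebra ^^ k) u = {0})"

definition conj_act :: "real^'n^'n \<Rightarrow> (real^'n^'n) set \<Rightarrow> (real^'n^'n) set" where
  "conj_act g u = (\<lambda>A. g ** A ** matrix_inv g) ` u"

definition SL_conjugate :: "(real^'n^'n) set \<Rightarrow> (real^'n^'n) set \<Rightarrow> bool" where
  "SL_conjugate u v \<longleftrightarrow> (\<exists>g\<in>SL. v = conj_act g u)"

definition mat_unit :: "'n \<Rightarrow> 'n \<Rightarrow> real^'n^'n" where
  "mat_unit i j = (\<chi> k l. if k = i \<and> l = j then 1 else 0)"

text \<open>
  The index type \<open>3\<close> has the elements \<open>1\<close>, \<open>2\<close>, \<open>3\<close> (where \<open>3 = 0\<close>).  The suffix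
  \<open>ab\<close> stands for the root \<open>\<alpha> + \<beta>\<close>; note the sign in its two root vectors.
\<close>

definition H_a :: "real^3^3" where "H_a = mat_unit 1 1 - mat_unit 2 2"
definition H_b :: "real^3^3" where "H_b = mat_unit 2 2 - mat_unit 3 3"
definition X_a :: "real^3^3" where "X_a = mat_unit 1 2"
definition X_b :: "real^3^3" where "X_b = mat_unit 2 3"
definition X_ab :: "real^3^3" where "X_ab = - mat_unit 1 3"
definition Y_a :: "real^3^3" where "Y_a = mat_unit 2 1"
definition Y_b :: "real^3^3" where "Y_b = mat_unit 3 2"
definition Y_ab :: "real^3^3" where "Y_ab = - mat_unit 3 1"

text \<open>
  Labels for the entries of the list, so that distinct entries and distinct parameter
  values are distinct labels.  The restriction on the parameter of \<open>U46\<close> is imposed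
  by the label set \<open>labels4\<close> below.
\<close>

datatype label = U41 | U42 | U43 | U44 | U45 | U46 real | U47 | U48 | U51

fun alg :: "label \<Rightarrow> (real^3^3) set" where
  "alg U41 = span {X_a, X_ab, H_a, H_b}"
| "alg U42 = span {X_a, X_ab, X_b - Y_b, 2 *\<^sub>R H_a + H_b}"
| "alg U43 = span {X_a, Y_b, H_a, H_b}"
| "alg U44 = span {X_a, Y_b, - X_ab + Y_ab, H_a - H_b}"
| "alg U45 = span {X_a, X_b, X_ab, H_a + H_b}"
| "alg (U46 a) = span {X_a, X_b, X_ab, a *\<^sub>R H_a + H_b}"
| "alg U47 = span {X_a, X_b, X_ab, H_a}"
| "alg U48 = span {X_a, X_b, X_ab, H_a - H_b}"
| "alg U51 = span {X_a, X_b, X_ab, H_a, H_b}"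

definition labels4 :: "label set" where
  "labels4 = {U41, U42, U43, U44, U45, U47, U48} \<union> {U46 a | a. a \<noteq> 1 \<and> a \<noteq> - 1}"

definition labels5 :: "label set" where
  "labels5 = {U51}"

end

theory Submission
  imports Defs
begin

text \<open>
  A solvable algebra has a nonzero abelian ideal, and \<open>[A, [A, X]] = 0\<close> for \<open>A\<close> in the ideal and
  \<open>X\<close> in the algebra.  This forces an invariant line or plane in \<open>\<real>\<^sup>3\<close>: the eigenline of a simple real
  eigenvalue of \<open>A\<close>, the image of \<open>A\<^sup>2\<close> for a nilpotent \<open>A\<close> of rank two, or the image or kernel of a
  rank one \<open>A\<close>.  Passing to \<open>- A\<^sup>T\<close> exchanges lines and planes, so a line may be assumed.  The same
  idea applied to the quotient by that line shows that the algebra is either triangularizable or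
  conjugate to \<open>U42\<close>.  A four-dimensional triangular algebra is the kernel of one linear form on the
  Borel subalgebra, and closure under brackets leaves few possible forms.  Non-conjugacy follows
  by counting invariant lines and planes and, for the algebras containing all strictly upper
  triangular matrices, from the fact that a conjugation between them preserves diagonal entries.
\<close>

section \<open>Solvable matrix Lie algebras and conjugation\<close>

lemma matrix_diff_ldistrib: "A ** (B - C) = A ** B - A ** C" for A :: "real^'n^'m"
  by (simp add: matrix_matrix_mult_def vec_eq_iff sum_subtractf right_diff_distrib)

lemma matrix_diff_rdistrib: "(A - B) ** C = A ** C - B ** C" for A :: "real^'n^'m"
  by (simp add: matrix_matrix_mult_def vec_eq_iff sum_subtractf left_diff_distrib)

lemma matrix_add_rdistrib: "(A + B) ** C = A ** C + B ** C" for A :: "real^'n^'m"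
  by (simp add: matrix_matrix_mult_def vec_eq_iff sum.distrib distrib_right)

lemma matrix_scaleR_left: "(c *\<^sub>R A) ** B = c *\<^sub>R (A ** B)" for A :: "real^'n^'m"
  by (simp add: scalar_matrix_assoc)

lemma matrix_scaleR_right: "A ** (c *\<^sub>R B) = c *\<^sub>R (A ** B)" for A :: "real^'n^'m"
  by (simp add: matrix_scalar_ac scalar_matrix_assoc)

lemma matrix_minus_left: "(- A) ** B = - (A ** B)" for A :: "real^'n^'m"
  by (simp add: matrix_matrix_mult_def vec_eq_iff sum_negf)

lemma matrix_minus_right: "A ** (- B) = - (A ** B)" for A :: "real^'n^'m"
  by (simp add: matrix_matrix_mult_def vec_eq_iff sum_negf)

lemma transpose_minus: "transpose (- A) = - transpose A" for A :: "real^'n^'m"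
  by (simp add: transpose_def vec_eq_iff)

lemma matrix_mult_zero [simp]: "A ** 0 = 0" "0 ** B = 0" for A :: "real^'n^'m" and B :: "real^'k^'n"
  by (simp_all add: matrix_matrix_mult_def vec_eq_iff)

lemmas matrix_ring_simps = matrix_diff_ldistrib matrix_diff_rdistrib matrix_add_ldistrib
  matrix_add_rdistrib matrix_scaleR_left matrix_scaleR_right
  matrix_minus_left matrix_minus_right matrix_mul_assoc

section \<open>Derived series and solvability\<close>

lemma subspace_derived_algebra: "subspace (derived_algebra u)"
  by (simp add: derived_algebra_def)

lemma derived_algebra_mono: "u \<subseteq> v \<Longrightarrow> derived_algebra u \<subseteq> derived_algebra v"
  unfolding derived_algebra_def by (rule span_mono) blast

lemma derived_algebra_least:
  assumes "subspace v" "\<And>A B. A \<in> u \<Longrightarrow> B \<in> u \<Longrightarrow> lie_bracket A B \<in> v"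
  shows "derived_algebra u \<subseteq> v"
  unfolding derived_algebra_def by (rule span_minimal) (use assms in auto)

lemma lie_bracket_mem_derived:
  "A \<in> u \<Longrightarrow> B \<in> u \<Longrightarrow> lie_bracket A B \<in> derived_algebra u"
  unfolding derived_algebra_def by (rule span_base) blast

lemma linear_lie_bracket_right: "linear (lie_bracket A)"
  by (rule linearI) (simp_all add: lie_bracket_def matrix_ring_simps scaleR_right_diff_distrib)

lemma lie_bracket_skew: "lie_bracket A B = - lie_bracket B A"
  by (simp add: lie_bracket_def)

lemma lie_bracket_jacobi:
  "lie_bracket A (lie_bracket B C) = lie_bracket (lie_bracket A B) C + lie_bracket B (lie_bracket A C)"
  by (simp add: lie_bracket_def matrix_ring_simps)

lemma lie_solvable_if_derived:
  assumes "lie_solvable (derived_algebra u)"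
  shows "lie_solvable u"
proof -
  obtain k where "(derived_algebra ^^ k) (derived_algebra u) = {0}"
    using assms unfolding lie_solvable_def by blast
  then have "(derived_algebra ^^ Suc k) u = {0}"
    by (simp add: funpow_Suc_right del: funpow.simps)
  then show ?thesis unfolding lie_solvable_def by blast
qed

lemma lie_solvable_subset:
  assumes "u \<subseteq> v" "0 \<in> u" "lie_solvable v"
  shows "lie_solvable u"
proof -
  obtain k where k: "(derived_algebra ^^ k) v = {0}"
    using assms unfolding lie_solvable_def by blast
  have "(derived_algebra ^^ k) u \<subseteq> (derived_algebra ^^ k) v"
    by (induction k) (simp_all add: assms(1) derived_algebra_mono)
  moreover have "0 \<in> (derived_algebra ^^ k) u"
    by (cases k) (auto simp: assms(2) subspace_0 subspace_derived_algebra)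
  ultimately show ?thesis using k unfolding lie_solvable_def by blast
qed

lemma lie_solvable_zero: "lie_solvable {0}"
  unfolding lie_solvable_def by (rule exI[of _ 0]) simp

text \<open>The last term of the derived series that is not contained in \<open>K\<close>.  For \<open>K = {0}\<close> this
  is a nonzero abelian ideal; larger \<open>K\<close> replace the passage to a quotient of \<open>u\<close>.\<close>

lemma lie_solvable_obtain_ideal:
  assumes "lie_solvable u" "subspace u" and closed: "\<And>A B. A \<in> u \<Longrightarrow> B \<in> u \<Longrightarrow> lie_bracket A B \<in> u"
    and "0 \<in> K" "\<not> u \<subseteq> K"
  obtains a where "a \<subseteq> u" "subspace a" "\<not> a \<subseteq> K"
    "\<And>A B. A \<in> u \<Longrightarrow> B \<in> a \<Longrightarrow> lie_bracket A B \<in> a"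
    "\<And>A B. A \<in> a \<Longrightarrow> B \<in> a \<Longrightarrow> lie_bracket A B \<in> K"
proof -
  let ?d = "\<lambda>j. (derived_algebra ^^ j) u"
  have ideal: "?d j \<subseteq> u \<and> subspace (?d j) \<and> (\<forall>A\<in>u. \<forall>B\<in>?d j. lie_bracket A B \<in> ?d j)" for j
  proof (induction j)
    case 0
    then show ?case using assms by simp
  next
    case (Suc j)
    let ?a = "?d j"
    have sub: "derived_algebra ?a \<subseteq> u"
      using Suc closed assms(2) by (intro derived_algebra_least) (auto 0 3)
    \<comment> \<open>By the Jacobi identity bracketing with \<open>A\<close> is a derivation, so it
      preserves the derived algebra of an ideal.\<close>
    have "derived_algebra ?a \<subseteq> {B. lie_bracket A B \<in> derived_algebra ?a}" if "A \<in> u" for A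
    proof (rule derived_algebra_least)
      show "subspace {B. lie_bracket A B \<in> derived_algebra ?a}"
        using linear_subspace_vimage[OF linear_lie_bracket_right subspace_derived_algebra]
        by (simp add: vimage_def)
      show "B \<in> ?a \<Longrightarrow> C \<in> ?a \<Longrightarrow> lie_bracket B C \<in> {B. lie_bracket A B \<in> derived_algebra ?a}" for B C
        using Suc that lie_bracket_jacobi[of A B C]
        by (auto intro!: subspace_add[OF subspace_derived_algebra] lie_bracket_mem_derived)
    qed
    then show ?case using sub by (auto simp: subspace_derived_algebra)
  qed
  obtain k where "?d k = {0}"
    using assms unfolding lie_solvable_def by blast
  then have k: "?d k \<subseteq> K" using assms by auto
  define m where "m = (LEAST j. ?d j \<subseteq> K)"
  have m: "?d m \<subseteq> K" unfolding m_def by (rule LeastI) (rule k)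
  \<comment> \<open>Index 0 is impossible because \<open>u\<close> itself is not contained in
    \<open>K\<close>.\<close>
  obtain j where j: "m = Suc j"
    using m assms(5) by (cases m) auto
  have "\<not> ?d j \<subseteq> K"
    using not_less_Least[of j "\<lambda>j. ?d j \<subseteq> K"] j unfolding m_def by auto
  moreover have "lie_bracket A B \<in> K" if "A \<in> ?d j" "B \<in> ?d j" for A B
    using lie_bracket_mem_derived[OF that] m j by auto
  ultimately show ?thesis using that[of "?d j"] ideal by blast
qed

lemma derived_algebra_image:
  assumes "linear f" "\<And>A B. lie_bracket (f A) (f B) = f (lie_bracket A B)"
  shows "derived_algebra (f ` u) = f ` derived_algebra u"
proof -
  have "{lie_bracket A B | A B. A \<in> f ` u \<and> B \<in> f ` u} = f ` {lie_bracket A B | A B. A \<in> u \<and> B \<in> u}"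
    by (force simp: assms(2)[symmetric])
  then show ?thesis
    by (simp add: derived_algebra_def linear_span_image assms(1))
qed

lemma lie_solvable_image:
  assumes "linear f" "\<And>A B. lie_bracket (f A) (f B) = f (lie_bracket A B)" "lie_solvable u"
  shows "lie_solvable (f ` u)"
proof -
  obtain k where "(derived_algebra ^^ k) u = {0}"
    using assms unfolding lie_solvable_def by blast
  moreover have "(derived_algebra ^^ k) (f ` u) = f ` (derived_algebra ^^ k) u"
    by (induction k) (simp_all add: derived_algebra_image assms)
  ultimately show ?thesis
    unfolding lie_solvable_def using linear_0[OF assms(1)] by (intro exI[of _ k]) auto
qed

lemma sl_subalgebra_image:
  assumes "linear f" "\<And>A B. lie_bracket (f A) (f B) = f (lie_bracket A B)"
    "\<And>A. trace A = 0 \<Longrightarrow> trace (f A) = 0" "sl_subalgebra u"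
  shows "sl_subalgebra (f ` u)"
  using assms by (auto simp: sl_subalgebra_def sl_def linear_subspace_image)

section \<open>Conjugation by invertible matrices\<close>

lemma linear_conj: "linear (\<lambda>A. g ** A ** h)" for g h :: "real^'n^'n"
  by (rule linearI) (simp_all add: matrix_ring_simps)

context
  fixes g :: "real^'n^'n"
  assumes inv: "invertible g"
begin

lemma inv_cancel: "matrix_inv g ** g = mat 1" "g ** matrix_inv g = mat 1"
  using someI_ex[OF inv[unfolded invertible_def]] by (simp_all add: matrix_inv_def)

lemma inv_cancel': "A ** matrix_inv g ** g = A" "A ** g ** matrix_inv g = A" for A :: "real^'n^'n"
  by (simp_all add: inv_cancel flip: matrix_mul_assoc)

lemma lie_bracket_conj:
  "lie_bracket (g ** A ** matrix_inv g) (g ** B ** matrix_inv g) = g ** lie_bracket A B ** matrix_inv g"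
  by (simp add: lie_bracket_def matrix_ring_simps inv_cancel')

lemma inj_conj: "inj (\<lambda>A. g ** A ** matrix_inv g)"
proof (rule injI)
  fix A B assume "g ** A ** matrix_inv g = g ** B ** matrix_inv g"
  then have "matrix_inv g ** (g ** A ** matrix_inv g) ** g = matrix_inv g ** (g ** B ** matrix_inv g) ** g"
    by simp
  then show "A = B" by (simp add: matrix_mul_assoc inv_cancel inv_cancel')
qed

lemma matrix_inv_unique:
  assumes "h ** g = mat 1"
  shows "matrix_inv g = h"
  by (metis assms inv_cancel(2) matrix_mul_assoc matrix_mul_lid matrix_mul_rid)

lemma trace_conj: "trace (g ** A ** matrix_inv g) = trace A"
  by (subst trace_mul_sym) (simp add: matrix_mul_assoc inv_cancel)

lemma lie_solvable_conj: "lie_solvable u \<Longrightarrow> lie_solvable (conj_act g u)"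
  unfolding conj_act_def by (rule lie_solvable_image) (auto simp: linear_conj lie_bracket_conj)

lemma sl_subalgebra_conj: "sl_subalgebra u \<Longrightarrow> sl_subalgebra (conj_act g u)"
  unfolding conj_act_def
  by (rule sl_subalgebra_image) (auto simp: linear_conj lie_bracket_conj trace_conj)

lemma dim_conj: "dim (conj_act g u) = dim u"
  unfolding conj_act_def
  by (intro dim_image_eq linear_conj inj_on_subset[OF inj_conj]) auto

end

lemma SL_conjugate_trans:
  assumes "SL_conjugate u v" "SL_conjugate v w" shows "SL_conjugate u w"
proof -
  obtain g h where gh: "det g = 1" "det h = 1" "v = conj_act g u" "w = conj_act h v"
    using assms by (auto simp: SL_conjugate_def SL_def)
  have i: "invertible g" "invertible h" using gh by (simp_all add: invertible_det_nz)
  have "matrix_inv (h ** g) = matrix_inv g ** matrix_inv h"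
    by (intro matrix_inv_unique invertible_mult i)
      (simp_all add: matrix_mul_assoc inv_cancel inv_cancel' i)
  then have "w = conj_act (h ** g) u"
    unfolding gh conj_act_def by (simp add: image_image matrix_mul_assoc)
  moreover have "det (h ** g) = 1" using gh by (simp add: det_mul)
  ultimately show ?thesis unfolding SL_conjugate_def SL_def by blast
qed

text \<open>Real cube roots exist, so conjugacy under \<open>GL\<close> and under \<open>SL\<close> agree.\<close>

lemma SL_conjugate_conj_act:
  fixes g :: "real^3^3"
  assumes "invertible g" shows "SL_conjugate u (conj_act g u)"
proof -
  \<comment> \<open>A scalar factor \<open>s\<close> leaves conjugation unchanged and multiplies the
    determinant by \<open>s ^ 3\<close>.\<close>
  define s where "s = root 3 (1 / det g)"
  have d: "det g \<noteq> 0" using assms by (simp add: invertible_det_nz)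
  have s: "s ^ 3 = 1 / det g" unfolding s_def by (rule odd_real_root_pow) simp
  then have s0: "s \<noteq> 0" using d by auto
  have "det (s *\<^sub>R g) = s ^ 3 * det g"
    by (simp add: det_3 power3_eq_cube algebra_simps)
  then have 1: "det (s *\<^sub>R g) = 1" using s d by simp
  have "matrix_inv (s *\<^sub>R g) = (1 / s) *\<^sub>R matrix_inv g"
    using 1 by (intro matrix_inv_unique) (simp_all add: invertible_det_nz matrix_ring_simps inv_cancel[OF assms] s0)
  then have "conj_act (s *\<^sub>R g) u = conj_act g u"
    using s0 by (simp add: conj_act_def matrix_ring_simps)
  then show ?thesis using 1 by (force simp: SL_conjugate_def SL_def)
qed

text \<open>The dimension bound turns an inclusion into an equality, so an explicit matrix with its
  inverse and one inclusion suffice.\<close>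

lemma SL_conjugateI:
  fixes g :: "real^3^3"
  assumes "h ** g = mat 1" "subspace u" "subspace v" "dim v \<le> dim u"
    "\<And>A. A \<in> u \<Longrightarrow> g ** A ** h \<in> v"
  shows "SL_conjugate u v"
proof -
  have g: "invertible g" using assms(1) invertible_left_inverse by blast
  have "conj_act g u = v"
  proof (rule subspace_dim_equal)
    show "subspace (conj_act g u)"
      unfolding conj_act_def using assms(2) by (intro linear_subspace_image linear_conj)
    show "conj_act g u \<subseteq> v"
      using assms(5) by (auto simp: conj_act_def matrix_inv_unique[OF g assms(1)])
  qed (use assms dim_conj[OF g] in auto)
  then show ?thesis using SL_conjugate_conj_act[OF g] by metis
qed

text \<open>The contragredient action on the dual space. The sign makes it a Lie algebra
  homomorphism, whereas the transpose alone reverses brackets.\<close>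

definition neg_transpose :: "real^'n^'n \<Rightarrow> real^'n^'n" where
  "neg_transpose A = - transpose A"

lemma linear_neg_transpose: "linear neg_transpose"
  by (rule linearI) (simp_all add: neg_transpose_def transpose_def vec_eq_iff)

lemma neg_transpose_neg_transpose [simp]: "neg_transpose (neg_transpose A) = A"
  by (simp add: neg_transpose_def transpose_def vec_eq_iff)

lemma neg_transpose_image_image [simp]: "neg_transpose ` neg_transpose ` u = u"
  by (simp add: image_image)

lemma inj_neg_transpose: "inj neg_transpose"
  by (metis injI neg_transpose_neg_transpose)

lemma lie_bracket_neg_transpose:
  "lie_bracket (neg_transpose A) (neg_transpose B) = neg_transpose (lie_bracket A B)"
  by (simp add: neg_transpose_def lie_bracket_def matrix_matrix_mult_def transpose_def vec_eq_iff
      mult.commute sum_subtractf)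

lemma trace_neg_transpose: "trace (neg_transpose A) = - trace A"
  by (simp add: neg_transpose_def trace_def transpose_def sum_negf)

lemma dim_neg_transpose: "dim (neg_transpose ` u) = dim u"
  by (intro dim_image_eq linear_neg_transpose inj_on_subset[OF inj_neg_transpose]) auto

text \<open>The negative transpose turns conjugation by \<open>g\<close> into conjugation by the
  inverse transpose of \<open>g\<close>, which again has determinant one.\<close>

lemma SL_conjugate_neg_transpose:
  assumes "SL_conjugate (neg_transpose ` u) v"
  shows "SL_conjugate u (neg_transpose ` v)"
proof -
  obtain g where g: "det g = 1" "v = conj_act g (neg_transpose ` u)"
    using assms by (auto simp: SL_conjugate_def SL_def)
  then have i: "invertible g" by (simp add: invertible_det_nz)
  define h where "h = transpose (matrix_inv g)"
  have hg: "matrix_inv h = transpose g" unfolding h_def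
    by (intro matrix_inv_unique transpose_invertible)
      (use inv_cancel[OF i] in \<open>auto simp: invertible_def simp flip: matrix_transpose_mul\<close>)
  have "det g * det (matrix_inv g) = 1" using inv_cancel[OF i] by (metis det_I det_mul)
  then have "det h = 1" using g by (simp add: h_def)
  moreover have "neg_transpose (g ** neg_transpose A ** matrix_inv g) = h ** A ** matrix_inv h" for A
    unfolding hg unfolding h_def neg_transpose_def
    by (simp add: matrix_transpose_mul transpose_minus matrix_ring_simps)
  then have "neg_transpose ` v = conj_act h u"
    by (simp add: g conj_act_def image_image)
  ultimately show ?thesis by (auto simp: SL_conjugate_def SL_def)
qed

section \<open>Existence of an invariant line or plane\<close>

text \<open>By the triple product expansion \<open>Lagrange\<close>, \<open>a\<close> is parallel to
  the normal of the plane spanned by \<open>v\<close> and \<open>w\<close>.\<close>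

lemma orthogonal_two_imp_cross:
  assumes "cross3 v w \<noteq> 0" "a \<bullet> v = 0" "a \<bullet> w = 0"
  obtains c where "a = c *\<^sub>R cross3 v w"
proof -
  have "cross3 (cross3 v w) a = 0"
    using assms(2,3) Lagrange[of a v w] by (subst cross_skew) simp
  then show ?thesis
    using assms(1) that by (auto simp: cross_eq_0 collinear_lemma intro: that[of 0])
qed

lemma cross_eq_0_iff_scaleR:
  assumes "v \<noteq> 0" shows "cross3 v w = 0 \<longleftrightarrow> (\<exists>c. w = c *\<^sub>R v)"
  using assms by (auto simp: cross_eq_0 collinear_lemma intro: exI[of _ 0])

text \<open>A kernel of dimension at least two means rank at most one: all rows are multiples of the
  same cross product.\<close>

lemma minors_zero_if_two_kernel_vectors:
  fixes M :: "real^3^3"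
  assumes "cross3 v w \<noteq> 0" "M *v v = 0" "M *v w = 0"
  shows "M $ i $ j * M $ k $ l = M $ i $ l * M $ k $ j"
proof -
  have "\<exists>c. M $ i = c *\<^sub>R cross3 v w" for i
    using orthogonal_two_imp_cross[OF assms(1), of "M $ i"] assms(2,3)
    by (metis matrix_vector_mul_component zero_index)
  then obtain c where "\<And>i. M $ i = c i *\<^sub>R cross3 v w" by metis
  then show ?thesis by simp
qed

text \<open>The sum of the principal minors of size two, which is the coefficient of
  \<open>t\<close> in the characteristic polynomial.\<close>

definition char2 :: "real^3^3 \<Rightarrow> real" where
  "char2 A = A$1$1 * A$2$2 - A$1$2 * A$2$1 + A$1$1 * A$3$3 - A$1$3 * A$3$1 + A$2$2 * A$3$3 - A$2$3 * A$3$2"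

lemmas mat3_simps = vec_eq_iff forall_3 sum_3 matrix_matrix_mult_def matrix_vector_mult_def mat_def

lemma cayley_hamilton_traceless:
  assumes "trace A = 0"
  shows "A ** A ** A = det A *\<^sub>R mat 1 - char2 A *\<^sub>R A"
proof -
  have a: "A$3$3 = - A$1$1 - A$2$2" using assms by (simp add: trace_def sum_3)
  show ?thesis
    by (simp add: mat3_simps det_3 char2_def a) (simp add: algebra_simps)
qed

lemma det_minus_scalar_traceless:
  assumes "trace A = 0"
  shows "det (A - t *\<^sub>R mat 1) = det A - t ^ 3 - char2 A * t"
proof -
  have a: "A$3$3 = - A$1$1 - A$2$2" using assms by (simp add: trace_def sum_3)
  show ?thesis
    by (simp add: det_3 char2_def a mat_def) (simp add: algebra_simps power3_eq_cube)
qed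

lemma depressed_cubic_root: "\<exists>t::real. t ^ 3 + b * t - d = 0"
proof -
  \<comment> \<open>Large enough that \<open>R * R + b\<close> is at least 1, so the cubic changes
    sign between \<open>- R\<close> and \<open>R\<close>.\<close>
  define R where "R = 1 + \<bar>b\<bar> + \<bar>d\<bar>"
  have "R \<ge> 1" "R \<ge> \<bar>d\<bar>" by (auto simp: R_def)
  have "R * R \<ge> R * 1" using \<open>R \<ge> 1\<close> by (intro mult_left_mono) auto
  then have "R * R + b \<ge> 1" unfolding mult_1_right using R_def by linarith
  then have "R * (R * R + b) \<ge> R * 1" using \<open>R \<ge> 1\<close> by (intro mult_left_mono) auto
  then have "(- R) ^ 3 + b * (- R) - d \<le> 0" "R ^ 3 + b * R - d \<ge> 0"
    using \<open>R \<ge> \<bar>d\<bar>\<close> by (auto simp: power3_eq_cube algebra_simps)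
  moreover have "continuous_on {- R..R} (\<lambda>t. t ^ 3 + b * t - d)"
    by (intro continuous_intros)
  ultimately show ?thesis
    using IVT'[of "\<lambda>t. t ^ 3 + b * t - d" "- R" 0 R] \<open>R \<ge> 1\<close> by auto
qed

text \<open>The derivative of the characteristic polynomial at \<open>t\<close> is \<open>- (3 * t\<^sup>2 + char2 A)\<close>, so this
  provides a simple real eigenvalue.\<close>

lemma simple_real_eigenvalue:
  assumes "trace A = 0" "A ** A ** A \<noteq> 0"
  obtains t v where "v \<noteq> 0" "A *v v = t *\<^sub>R v" "3 * t\<^sup>2 + char2 A \<noteq> 0" "det A = t ^ 3 + char2 A * t"
proof -
  obtain s where s: "s ^ 3 + char2 A * s - det A = 0" using depressed_cubic_root by blast
  have "\<exists>t. t ^ 3 + char2 A * t - det A = 0 \<and> 3 * t\<^sup>2 + char2 A \<noteq> 0"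
  proof (cases "3 * s\<^sup>2 + char2 A = 0")
    case True
    \<comment> \<open>If the multiple root \<open>s\<close> were 0, then \<open>char2 A\<close> and
      \<open>det A\<close> would vanish, and \<open>A ** A ** A = 0\<close> by Cayley-Hamilton. The
      roots sum to zero, so the remaining root is \<open>- 2 * s\<close>.\<close>
    have "s \<noteq> 0"
      using assms(2) True s by (auto simp: cayley_hamilton_traceless[OF assms(1)])
    moreover have "char2 A = - 3 * s\<^sup>2" using True by simp
    ultimately show ?thesis
      using s by (intro exI[of _ "- 2 * s"]) (auto simp: power2_eq_square power3_eq_cube)
  qed (use s in blast)
  then obtain t where t: "t ^ 3 + char2 A * t - det A = 0" "3 * t\<^sup>2 + char2 A \<noteq> 0" by blast
  have "det (A - t *\<^sub>R mat 1) = 0"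
    using t by (simp add: det_minus_scalar_traceless[OF assms(1)])
  then obtain v where "v \<noteq> 0" "(A - t *\<^sub>R mat 1) *v v = 0"
    using matrix_left_invertible_ker[of "A - t *\<^sub>R mat 1"] invertible_det_nz[of "A - t *\<^sub>R mat 1"]
      invertible_left_inverse by blast
  then show ?thesis
    using that[of v t] t
    by (auto simp: matrix_vector_mult_diff_rdistrib simp flip: scaleR_matrix_vector_assoc)
qed

text \<open>Two independent eigenvectors would give \<open>A - t *\<^sub>R mat 1\<close> rank at
  most one. Its principal minors of size two would then vanish, and for traceless \<open>A\<close>
  their sum is \<open>3 * t\<^sup>2 + char2 A\<close>.\<close>

lemma simple_eigenvectors_parallel:
  assumes "trace A = 0" "3 * t\<^sup>2 + char2 A \<noteq> 0" "v \<noteq> 0" "A *v v = t *\<^sub>R v" "A *v w = t *\<^sub>R w"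
  obtains c where "w = c *\<^sub>R v"
proof -
  let ?M = "A - t *\<^sub>R mat 1"
  have k: "?M *v v = 0" "?M *v w = 0"
    using assms(4,5) by (auto simp: matrix_vector_mult_diff_rdistrib simp flip: scaleR_matrix_vector_assoc)
  have a: "A$3$3 = - A$1$1 - A$2$2" using assms by (simp add: trace_def sum_3)
  have "cross3 v w = 0"
  proof (rule ccontr)
    assume "cross3 v w \<noteq> 0"
    note m = minors_zero_if_two_kernel_vectors[OF this k]
    have "3 * t\<^sup>2 + char2 A = 0"
      using m[of 1 1 2 2] m[of 1 1 3 3] m[of 2 2 3 3]
      by (simp add: mat_def char2_def a power2_eq_square) (simp add: algebra_simps)
    then show False using assms(2) by simp
  qed
  then show ?thesis using that cross_eq_0_iff_scaleR[OF assms(3)] by blast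
qed

text \<open>A matrix of rank at most one satisfies \<open>A ** A = trace A *\<^sub>R A\<close>, so a
  traceless one would square to zero.\<close>

lemma square_nonzero_kernel_parallel:
  fixes A :: "real^3^3"
  assumes "trace A = 0" "A ** A \<noteq> 0" "v \<noteq> 0" "A *v v = 0" "A *v w = 0"
  obtains c where "w = c *\<^sub>R v"
proof -
  have a: "A$3$3 = - A$1$1 - A$2$2" using assms by (simp add: trace_def sum_3)
  have "cross3 v w = 0"
  proof (rule ccontr)
    assume "cross3 v w \<noteq> 0"
    note m = minors_zero_if_two_kernel_vectors[OF this assms(4,5)]
    have "(A ** A) $ i $ j = A $ i $ j * trace A" for i j
      by (simp add: matrix_matrix_mult_def trace_def sum_distrib_left m[of i _ _ j])
    then show False using assms(1,2) by (simp add: vec_eq_iff)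
  qed
  then show ?thesis using that cross_eq_0_iff_scaleR[OF assms(3)] by blast
qed

text \<open>All columns lie in the kernel. Two independent columns would force rank at most one, a
  contradiction, so every column is a multiple of one nonzero column.\<close>

lemma square_zero_outer:
  fixes A :: "real^3^3"
  assumes "A ** A = 0" "A \<noteq> 0"
  obtains v w where "v \<noteq> 0" "w \<noteq> 0" "\<And>i j. A $ i $ j = v $ i * w $ j"
proof -
  have ker: "A *v column j A = 0" for j
    using assms(1) by (simp add: column_def matrix_vector_mult_def matrix_matrix_mult_def vec_eq_iff)
  obtain k where k: "column k A \<noteq> 0"
    using assms(2) by (auto simp: column_def vec_eq_iff)
  have "cross3 (column k A) (column j A) = 0" for j
  proof (rule ccontr)
    assume *: "cross3 (column k A) (column j A) \<noteq> 0"
    note m = minors_zero_if_two_kernel_vectors[OF * ker ker]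
    have "cross3 (column k A) (column j A) = 0"
      using m[of 1 k 2 j] m[of 1 k 3 j] m[of 2 k 3 j]
      by (simp add: cross3_def column_def vec_eq_iff forall_3 algebra_simps)
    then show False using * by simp
  qed
  then have "\<forall>j. \<exists>c. column j A = c *\<^sub>R column k A"
    by (simp add: cross_eq_0_iff_scaleR[OF k])
  then obtain c where c: "\<And>j. column j A = c j *\<^sub>R column k A"
    using choice[of "\<lambda>j c. column j A = c *\<^sub>R column k A"] by blast
  have "A $ i $ j = column k A $ i * (\<chi> j. c j) $ j" for i j
    using c[of j] by (simp add: column_def vec_eq_iff)
  moreover have "(\<chi> j. c j) \<noteq> 0"
    using c[of k] k by (auto simp: vec_eq_iff intro!: exI[of _ k])
  ultimately show ?thesis using that k by blast
qed

section \<open>Invariant lines from vanishing double brackets\<close>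

lemma double_bracket_expand:
  fixes A :: "real^'n^'n"
  shows
  "lie_bracket A (lie_bracket A X) = A ** A ** X - 2 *\<^sub>R (A ** X ** A) + X ** A ** A"
  by (simp add: lie_bracket_def matrix_ring_simps) (simp add: vec_eq_iff)

text \<open>Applied to an eigenvector \<open>v\<close> for \<open>t\<close>, the vanishing double
  bracket says that \<open>X *v v\<close> is killed by the square of
  \<open>A - t *\<^sub>R mat 1\<close>. For a simple eigenvalue this generalized eigenspace is the
  line of \<open>v\<close>.\<close>

lemma invariant_line_if_simple_eigenvalue:
  fixes A :: "real^3^3"
  assumes "trace A = 0" "A ** A ** A \<noteq> 0"
  obtains v where "v \<noteq> 0"
    "\<And>X. lie_bracket A (lie_bracket A X) = 0 \<Longrightarrow> \<exists>c. X *v v = c *\<^sub>R v"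
proof -
  obtain t v where v: "v \<noteq> 0" "A *v v = t *\<^sub>R v" and t: "3 * t\<^sup>2 + char2 A \<noteq> 0"
    and d: "det A = t ^ 3 + char2 A * t"
    using simple_real_eigenvalue[OF assms] by metis
  note lin = matrix_vector_mult_diff_rdistrib matrix_vector_mult_add_rdistrib
    matrix_vector_mult_diff_distrib matrix_vector_right_distrib
    matrix_vector_mult_scaleR scaleR_matrix_vector_assoc[symmetric] matrix_vector_mul_assoc[symmetric]
  have "\<exists>c. X *v v = c *\<^sub>R v" if "lie_bracket A (lie_bracket A X) = 0" for X
  proof -
    define z where "z = X *v v"
    define y where "y = A *v z - t *\<^sub>R z"
    have "(A ** A ** X - 2 *\<^sub>R (A ** X ** A) + X ** A ** A) *v v = 0"
      using that by (simp add: double_bracket_expand)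
    then have "A *v (A *v z) - (2 * t) *\<^sub>R (A *v z) + t\<^sup>2 *\<^sub>R z = 0"
      by (simp add: lin v(2) z_def power2_eq_square)
    then have "A *v y = t *\<^sub>R y"
      by (simp add: y_def lin power2_eq_square) (simp add: vec_eq_iff algebra_simps)
    then obtain c where c: "y = c *\<^sub>R v"
      using simple_eigenvectors_parallel[OF assms(1) t v] by blast
    then have Az: "A *v z = t *\<^sub>R z + c *\<^sub>R v" by (simp add: y_def algebra_simps)
    \<comment> \<open>Cayley-Hamilton excludes a Jordan block at \<open>t\<close>: comparing both
      sides on \<open>z\<close> leaves \<open>c\<close> times the derivative
      \<open>3 * t\<^sup>2 + char2 A\<close>, so \<open>c = 0\<close>.\<close>
    have eq: "(A ** A ** A) *v z = (det A *\<^sub>R mat 1 - char2 A *\<^sub>R A) *v z"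
      by (simp add: cayley_hamilton_traceless[OF assms(1)])
    have "(c * (3 * t\<^sup>2 + char2 A)) * v $ i = 0" for i
    proof -
      have "c * (char2 A * v $ i) + c * (t * (t * (v $ i * 3))) = 0"
        using arg_cong[OF eq, of "\<lambda>x. x $ i"]
        by (simp add: lin Az v(2) d power2_eq_square power3_eq_cube) (simp add: algebra_simps)
      moreover have "(c * (3 * t\<^sup>2 + char2 A)) * v $ i = c * (char2 A * v $ i) + c * (t * (t * (v $ i * 3)))"
        by (simp add: power2_eq_square algebra_simps)
      ultimately show ?thesis by linarith
    qed
    then have "(c * (3 * t\<^sup>2 + char2 A)) *\<^sub>R v = 0"
      by (simp only: vec_eq_iff vector_scaleR_component zero_index simp_thms real_scaleR_def)
    then have "c = 0" using t v(1) by simp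
    then have "A *v z = t *\<^sub>R z" using Az by simp
    then show ?thesis
      using simple_eigenvectors_parallel[OF assms(1) t v] unfolding z_def by metis
  qed
  then show ?thesis using that v(1) by blast
qed

text \<open>For a single nilpotent Jordan block the image of \<open>A ** A\<close> is the kernel of
  \<open>A\<close>, so it suffices to show \<open>A ** X ** A ** A = 0\<close>.\<close>

lemma invariant_line_if_regular_nilpotent:
  fixes A :: "real^3^3"
  assumes "trace A = 0" "A ** A ** A = 0" "A ** A \<noteq> 0"
  obtains v where "v \<noteq> 0"
    "\<And>X. lie_bracket A (lie_bracket A X) = 0 \<Longrightarrow> \<exists>c. X *v v = c *\<^sub>R v"
proof -
  obtain y where y: "A ** A *v y \<noteq> 0"
    using assms(3) by (metis matrix_eq matrix_vector_mult_0)
  define v where "v = A ** A *v y"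
  have "A *v v = 0" using assms(2) by (simp add: v_def matrix_vector_mul_assoc matrix_mul_assoc)
  have "\<exists>c. X *v v = c *\<^sub>R v" if "lie_bracket A (lie_bracket A X) = 0" for X
  proof -
    have E: "A ** A ** X - 2 *\<^sub>R (A ** X ** A) + X ** A ** A = 0"
      using that by (simp add: double_bracket_expand)
    have 3: "B ** A ** A ** A = 0" for B
      using assms(2) by (metis matrix_mul_assoc matrix_mult_zero(1))
    \<comment> \<open>Multiplying by \<open>A\<close> on the right and on the left makes each of
      \<open>A ** A ** X ** A\<close> and \<open>A ** X ** A ** A\<close> twice the other, so both
      vanish.\<close>
    have "A ** A ** X ** A - 2 *\<^sub>R (A ** X ** A ** A) = 0"
      using arg_cong[OF E, of "\<lambda>B. B ** A"] by (simp add: matrix_ring_simps 3)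
    moreover have "A ** X ** A ** A - 2 *\<^sub>R (A ** A ** X ** A) = 0"
      using arg_cong[OF E, of "\<lambda>B. A ** B"] by (simp add: matrix_ring_simps assms(2))
    ultimately have "A ** X ** A ** A = 0"
      by (simp add: vec_eq_iff)
    then have "A *v (X *v v) = 0"
      by (simp add: v_def matrix_vector_mul_assoc matrix_mul_assoc)
    then show ?thesis
      using square_nonzero_kernel_parallel[OF assms(1,3) y[folded v_def] \<open>A *v v = 0\<close>] by metis
  qed
  then show ?thesis using that y[folded v_def] by blast
qed

lemma vector_matrix_mult_add_right: "w v* (A + B) = w v* A + w v* B" for w :: "real^'n"
  by (simp add: vector_matrix_mult_def vec_eq_iff sum.distrib distrib_right distrib_left)

text \<open>Upgrades an alternative for each single element to a uniform one: the sum of an element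
  outside \<open>p\<close> and one outside \<open>q\<close> would lie in neither.\<close>

lemma subspace_subset_Un:
  assumes "subspace u" "subspace p" "subspace q" "u \<subseteq> p \<union> q"
  shows "u \<subseteq> p \<or> u \<subseteq> q"
proof (rule ccontr)
  assume "\<not> ?thesis"
  then obtain x y where "x \<in> u" "x \<notin> p" "y \<in> u" "y \<notin> q" by blast
  then have "x \<in> q" "y \<in> p" "x + y \<in> u" using assms by (auto simp: subspace_add)
  then have "x + y \<in> p \<or> x + y \<in> q" using assms by blast
  then show False
    using \<open>x \<in> q\<close> \<open>y \<in> p\<close> \<open>x \<notin> p\<close> \<open>y \<notin> q\<close>
    by (metis add_diff_cancel_left' add_diff_cancel_right' assms(2,3) subspace_diff)
qed

text \<open>A common row eigenvector \<open>w\<close> stands for the invariant plane orthogonal to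
  \<open>w\<close>. The cases follow the nilpotency of the elements of an abelian ideal.\<close>

lemma solvable_invariant_line_or_plane:
  fixes u :: "(real^3^3) set"
  assumes u: "sl_subalgebra u" "lie_solvable u" "\<not> u \<subseteq> {0}"
  shows "(\<exists>v. v \<noteq> 0 \<and> (\<forall>X\<in>u. \<exists>c. X *v v = c *\<^sub>R v)) \<or>
    (\<exists>w. w \<noteq> 0 \<and> (\<forall>X\<in>u. \<exists>c. w v* X = c *\<^sub>R w))"
proof -
  have su: "subspace u" and tr: "\<And>A. A \<in> u \<Longrightarrow> trace A = 0"
    using u by (auto simp: sl_subalgebra_def sl_def)
  obtain a where sa: "subspace a" and a: "a \<subseteq> u" "\<not> a \<subseteq> {0}"
    and ideal: "\<And>A B. A \<in> u \<Longrightarrow> B \<in> a \<Longrightarrow> lie_bracket A B \<in> a"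
    and abelian: "\<And>A B. A \<in> a \<Longrightarrow> B \<in> a \<Longrightarrow> lie_bracket A B = 0"
    by (rule lie_solvable_obtain_ideal[OF u(2) su _ _ u(3)])
      (use u(1) in \<open>auto simp: sl_subalgebra_def\<close>)
  have ideal': "lie_bracket B A \<in> a" if "A \<in> u" "B \<in> a" for A B
    using subspace_neg[OF sa ideal[OF that]] by (subst lie_bracket_skew)
  have db: "lie_bracket A (lie_bracket A X) = 0" if "A \<in> a" "X \<in> u" for A X
    using that by (intro abelian ideal')
  consider (reg) A where "A \<in> a" "A ** A ** A \<noteq> 0"
    | (nil) A where "A \<in> a" "A ** A ** A = 0" "A ** A \<noteq> 0"
    | (sq) "\<forall>A\<in>a. A ** A = 0" by blast
  then show ?thesis
  proof cases
    case reg
    then show ?thesis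
      using invariant_line_if_simple_eigenvalue[OF tr reg(2)] a(1) db by (metis subsetD)
  next
    case nil
    then show ?thesis
      using invariant_line_if_regular_nilpotent[OF tr nil(2,3)] a(1) db by (metis subsetD)
  next
    case sq
    obtain A where A: "A \<in> a" "A \<noteq> 0" using a(2) by blast
    have A2: "A ** A = 0" using sq A by blast
    obtain v w where vw: "v \<noteq> 0" "w \<noteq> 0" "\<And>i j. A $ i $ j = v $ i * w $ j"
      using square_zero_outer[OF A2 A(2)] by metis
    \<comment> \<open>\<open>A ** Y ** A\<close> is \<open>A\<close> scaled by the number
      \<open>w \<bullet> (Y *v v)\<close>.\<close>
    have outer: "w \<bullet> (Y *v v) = 0" if "A ** Y ** A = 0" for Y
    proof -
      have "(A ** Y ** A) $ i $ j = v $ i * (w \<bullet> (Y *v v)) * w $ j" for i j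
        by (simp add: mat3_simps vw(3) inner_vec_def algebra_simps)
      moreover obtain i j where "v $ i \<noteq> 0" "w $ j \<noteq> 0" using vw by (auto simp: vec_eq_iff)
      ultimately show ?thesis using that by (metis mult_eq_0_iff zero_index)
    qed
    have "cross3 v (X *v v) = 0 \<or> cross3 w (w v* X) = 0" if X: "X \<in> u" for X
    proof (cases "cross3 v (X *v v) = 0")
      \<comment> \<open>If \<open>v\<close> and \<open>X *v v\<close> are independent, they span the
        plane orthogonal to \<open>w\<close>. Both \<open>w\<close> and \<open>w v* X\<close> turn
        out to be normal to this plane, hence parallel.\<close>
      case p: False
      have A2': "B ** A ** A = 0" for B
        using A2 by (metis matrix_mul_assoc matrix_mult_zero(1))
      have x1: "A ** X ** A = 0"
        using db[OF A(1) X] by (simp add: double_bracket_expand A2 A2')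
      \<comment> \<open>This bracket lies in the ideal, where squares vanish; given
        \<open>x1\<close>, only the term \<open>A ** (X ** X) ** A\<close> of its square
        survives.\<close>
      have "lie_bracket X A ** lie_bracket X A = 0" using sq ideal X A by blast
      then have x2: "A ** (X ** X) ** A = 0"
        using x1 by (simp add: lie_bracket_def matrix_ring_simps A2') (metis matrix_mul_assoc matrix_mult_zero)
      have "w \<bullet> v = 0" using outer[of "mat 1"] A2 by simp
      moreover have wX: "w \<bullet> (X *v v) = 0" "w \<bullet> (X *v (X *v v)) = 0"
        using outer[OF x1] outer[OF x2] by (simp_all add: matrix_vector_mul_assoc)
      ultimately obtain c where c: "w = c *\<^sub>R cross3 v (X *v v)"
        using orthogonal_two_imp_cross[OF p] by metis
      obtain d where "w v* X = d *\<^sub>R cross3 v (X *v v)"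
        using orthogonal_two_imp_cross[OF p, of "w v* X"] wX by (metis dot_lmul_matrix)
      then show ?thesis using c by (simp add: cross_mult_left cross_mult_right)
    qed simp
    moreover have "subspace {X. cross3 v (X *v v) = 0}" "subspace {X. cross3 w (w v* X) = 0}"
      by (auto simp: subspace_def matrix_vector_mult_add_rdistrib vector_matrix_mult_add_right
          vector_scaleR_matrix_ac cross_add_right cross_mult_right
          simp flip: scaleR_matrix_vector_assoc)
    ultimately have "u \<subseteq> {X. cross3 v (X *v v) = 0} \<or> u \<subseteq> {X. cross3 w (w v* X) = 0}"
      using su by (intro subspace_subset_Un) auto
    then show ?thesis
      using cross_eq_0_iff_scaleR vw(1,2) by (metis (mono_tags, lifting) mem_Collect_eq subsetD)
  qed
qed

section \<open>The algebras of the list\<close>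

lemma span_eq_if:
  assumes "S \<subseteq> V" "subspace V" "\<And>A. A \<in> V \<Longrightarrow> A \<in> span S"
  shows "span S = V"
  using span_minimal[OF assms(1,2)] assms(3) by blast

lemma mat_unit_nth: "mat_unit i j $ k $ l = (if k = i \<and> l = j then 1 else 0)"
  by (simp add: mat_unit_def)

lemmas root_vector_defs = H_a_def H_b_def X_a_def X_b_def X_ab_def Y_a_def Y_b_def Y_ab_def

lemmas root_vector_simps = root_vector_defs mat_unit_nth vec_eq_iff forall_3

text \<open>The equation for \<open>A$2$2\<close> is tracelessness; \<open>s = t = 0\<close> gives the standard Borel subalgebra.\<close>

definition borel_line :: "real \<Rightarrow> real \<Rightarrow> (real^3^3) set" where
  "borel_line s t = {A. A$2$1 = 0 \<and> A$3$1 = 0 \<and> A$3$2 = 0 \<and> A$2$2 = - A$1$1 - A$3$3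
     \<and> s * A$1$1 + t * A$3$3 = 0}"

lemma subspace_borel_line: "subspace (borel_line s t)"
  by (auto simp: borel_line_def subspace_def distrib_left distrib_right)
    (simp_all add: algebra_simps flip: distrib_left)

text \<open>The diagonal of \<open>p *\<^sub>R H_a + q *\<^sub>R H_b\<close> is \<open>p\<close>,
  \<open>q - p\<close>, \<open>- q\<close>, which is why the parameters change places.\<close>

lemma span_eq_borel_line:
  assumes "p \<noteq> 0 \<or> q \<noteq> 0"
  shows "span {X_a, X_b, X_ab, p *\<^sub>R H_a + q *\<^sub>R H_b} = borel_line q p"
proof (rule span_eq_if[OF _ subspace_borel_line])
  show "{X_a, X_b, X_ab, p *\<^sub>R H_a + q *\<^sub>R H_b} \<subseteq> borel_line q p"
    by (auto simp: borel_line_def root_vector_simps)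
  fix A assume A: "A \<in> borel_line q p"
  obtain c where "A$1$1 = c * p" "A$3$3 = - c * q"
  proof (cases "p = 0")
    case True
    then show ?thesis using assms A that[of "- A$3$3 / q"] by (simp add: borel_line_def)
  next
    case False
    then show ?thesis using A that[of "A$1$1 / p"]
      by (simp add: borel_line_def field_simps)
  qed
  then have "A = A$1$2 *\<^sub>R X_a + A$2$3 *\<^sub>R X_b - A$1$3 *\<^sub>R X_ab + c *\<^sub>R (p *\<^sub>R H_a + q *\<^sub>R H_b)"
    using A by (simp add: borel_line_def root_vector_simps algebra_simps)
  then show "A \<in> span {X_a, X_b, X_ab, p *\<^sub>R H_a + q *\<^sub>R H_b}"
    by (rule ssubst) (blast intro: span_add span_diff span_scale span_base)
qed

text \<open>These entries form a projective line: the parameters \<open>1\<close> and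
  \<open>- 1\<close> left out of \<open>U46\<close> are \<open>U45\<close> and \<open>U48\<close>,
  and \<open>U47\<close> is the point at infinity.\<close>

lemma alg_borel_line:
  "alg U45 = borel_line 1 1" "alg (U46 a) = borel_line 1 a"
  "alg U47 = borel_line 0 1" "alg U48 = borel_line 1 (- 1)"
proof -
  have "{X_a, X_b, X_ab, H_a - H_b} = {X_a, X_b, X_ab, 1 *\<^sub>R H_a + (- 1) *\<^sub>R H_b}" by simp
  then have "alg U48 = borel_line (- 1) 1"
    by (simp only: alg.simps) (rule span_eq_borel_line, simp)
  moreover have "- 1 * x + 1 * y = 0 \<longleftrightarrow> 1 * x + - 1 * y = 0" for x y :: real
    by auto
  ultimately show "alg U48 = borel_line 1 (- 1)" by (simp only: borel_line_def)
qed (use span_eq_borel_line[of 1 1] span_eq_borel_line[of a 1] span_eq_borel_line[of 1 0] in simp_all)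

lemma alg_U51: "alg U51 = borel_line 0 0"
proof -
  have "span {X_a, X_b, X_ab, H_a, H_b} = borel_line 0 0"
  proof (rule span_eq_if[OF _ subspace_borel_line])
    fix A assume "A \<in> borel_line 0 0"
    then have "A = A$1$2 *\<^sub>R X_a + A$2$3 *\<^sub>R X_b - A$1$3 *\<^sub>R X_ab + A$1$1 *\<^sub>R H_a - A$3$3 *\<^sub>R H_b"
      by (simp add: borel_line_def root_vector_simps)
    then show "A \<in> span {X_a, X_b, X_ab, H_a, H_b}"
      by (rule ssubst) (blast intro: span_add span_diff span_scale span_base)
  qed (auto simp: borel_line_def root_vector_simps)
  then show ?thesis by simp
qed

text \<open>Equations in place of generators reduce membership, brackets and invariant vectors to
  computations with entries.\<close>

lemma alg_U41:
  "alg U41 = {A. A$2$1 = 0 \<and> A$3$1 = 0 \<and> A$2$3 = 0 \<and> A$3$2 = 0 \<and> A$2$2 = - A$1$1 - A$3$3}" (is "_ = ?V")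
proof -
  have "span {X_a, X_ab, H_a, H_b} = ?V"
  proof (rule span_eq_if)
    fix A assume "A \<in> ?V"
    then have "A = A$1$2 *\<^sub>R X_a - A$1$3 *\<^sub>R X_ab + A$1$1 *\<^sub>R H_a - A$3$3 *\<^sub>R H_b"
      by (simp add: root_vector_simps)
    then show "A \<in> span {X_a, X_ab, H_a, H_b}"
      by (rule ssubst) (blast intro: span_add span_diff span_scale span_base)
  qed (auto simp: root_vector_simps subspace_def right_diff_distrib)
  then show ?thesis by simp
qed

lemma alg_U42:
  "alg U42 = {A. A$2$1 = 0 \<and> A$3$1 = 0 \<and> A$2$2 = A$3$3 \<and> A$3$2 = - A$2$3 \<and> A$1$1 = - 2 * A$3$3}" (is "_ = ?V")
proof -
  have "span {X_a, X_ab, X_b - Y_b, 2 *\<^sub>R H_a + H_b} = ?V"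
  proof (rule span_eq_if)
    fix A assume "A \<in> ?V"
    then have "A = A$1$2 *\<^sub>R X_a - A$1$3 *\<^sub>R X_ab + A$2$3 *\<^sub>R (X_b - Y_b) - A$3$3 *\<^sub>R (2 *\<^sub>R H_a + H_b)"
      by (simp add: root_vector_simps)
    then show "A \<in> span {X_a, X_ab, X_b - Y_b, 2 *\<^sub>R H_a + H_b}"
      by (rule ssubst) (blast intro: span_add span_diff span_scale span_base)
  qed (auto simp: root_vector_simps subspace_def right_diff_distrib)
  then show ?thesis by simp
qed

lemma alg_U43:
  "alg U43 = {A. A$2$1 = 0 \<and> A$3$1 = 0 \<and> A$2$3 = 0 \<and> A$1$3 = 0 \<and> A$2$2 = - A$1$1 - A$3$3}" (is "_ = ?V")
proof -
  have "span {X_a, Y_b, H_a, H_b} = ?V"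
  proof (rule span_eq_if)
    fix A assume "A \<in> ?V"
    then have "A = A$1$2 *\<^sub>R X_a + A$3$2 *\<^sub>R Y_b + A$1$1 *\<^sub>R H_a - A$3$3 *\<^sub>R H_b"
      by (simp add: root_vector_simps)
    then show "A \<in> span {X_a, Y_b, H_a, H_b}"
      by (rule ssubst) (blast intro: span_add span_diff span_scale span_base)
  qed (auto simp: root_vector_simps subspace_def right_diff_distrib)
  then show ?thesis by simp
qed

lemma alg_U44:
  "alg U44 = {A. A$2$1 = 0 \<and> A$2$3 = 0 \<and> A$1$1 = A$3$3 \<and> A$3$1 = - A$1$3 \<and> A$2$2 = - 2 * A$3$3}" (is "_ = ?V")
proof -
  have "span {X_a, Y_b, - X_ab + Y_ab, H_a - H_b} = ?V"
  proof (rule span_eq_if)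
    fix A assume "A \<in> ?V"
    then have "A = A$1$2 *\<^sub>R X_a + A$3$2 *\<^sub>R Y_b + A$1$3 *\<^sub>R (- X_ab + Y_ab) + A$3$3 *\<^sub>R (H_a - H_b)"
      by (simp add: root_vector_simps)
    then show "A \<in> span {X_a, Y_b, - X_ab + Y_ab, H_a - H_b}"
      by (rule ssubst) (blast intro: span_add span_diff span_scale span_base)
  qed (auto simp: root_vector_simps subspace_def right_diff_distrib)
  then show ?thesis by simp
qed

section \<open>Dimensions of the listed algebras\<close>

lemma dim_alg_U41: "dim (alg U41) = 4"
proof -
  have "independent {X_a, X_ab, H_a, H_b}" "card {X_a, X_ab, H_a, H_b} = 4"
    by (auto simp: independent_insert span_breakdown_eq card_insert_if root_vector_simps)
  then show ?thesis by (simp add: dim_eq_card_independent)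
qed

lemma dim_alg_U42: "dim (alg U42) = 4"
proof -
  have "independent {X_a, X_ab, X_b - Y_b, 2 *\<^sub>R H_a + H_b}" "card {X_a, X_ab, X_b - Y_b, 2 *\<^sub>R H_a + H_b} = 4"
    by (auto simp: independent_insert span_breakdown_eq card_insert_if root_vector_simps)
  then show ?thesis by (simp add: dim_eq_card_independent)
qed

lemma dim_alg_U43: "dim (alg U43) = 4"
proof -
  have "independent {X_a, Y_b, H_a, H_b}" "card {X_a, Y_b, H_a, H_b} = 4"
    by (auto simp: independent_insert span_breakdown_eq card_insert_if root_vector_simps)
  then show ?thesis by (simp add: dim_eq_card_independent)
qed

lemma dim_alg_U44: "dim (alg U44) = 4"
proof -
  have "independent {X_a, Y_b, - X_ab + Y_ab, H_a - H_b}" "card {X_a, Y_b, - X_ab + Y_ab, H_a - H_b} = 4"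
    by (auto simp: independent_insert span_breakdown_eq card_insert_if root_vector_simps)
  then show ?thesis by (simp add: dim_eq_card_independent)
qed

lemma dim_alg_U51: "dim (alg U51) = 5"
proof -
  have "independent {X_a, X_b, X_ab, H_a, H_b}" "card {X_a, X_b, X_ab, H_a, H_b} = 5"
    by (auto simp: independent_insert span_breakdown_eq card_insert_if root_vector_simps)
  then show ?thesis by (simp add: dim_eq_card_independent)
qed

lemma dim_borel_line:
  assumes "s \<noteq> 0 \<or> t \<noteq> 0" shows "dim (borel_line s t) = 4"
proof -
  have "independent {X_a, X_b, X_ab, t *\<^sub>R H_a + s *\<^sub>R H_b}" "card {X_a, X_b, X_ab, t *\<^sub>R H_a + s *\<^sub>R H_b} = 4"
    using assms by (auto simp: independent_insert span_breakdown_eq card_insert_if root_vector_simps)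
  then show ?thesis using span_eq_borel_line[of t s] assms
    by (metis dim_span_eq_card_independent)
qed

section \<open>Closure under brackets and solvability of the listed algebras\<close>

lemma subspace_alg: "subspace (alg e)"
  by (cases e) simp_all

lemma sl_subalgebra_borel_line: "sl_subalgebra (borel_line s t)"
  unfolding sl_subalgebra_def
proof (intro conjI ballI subspace_borel_line)
  show "lie_bracket A B \<in> borel_line s t" if "A \<in> borel_line s t" "B \<in> borel_line s t" for A B
    using that by (simp add: borel_line_def lie_bracket_def matrix_matrix_mult_def sum_3)
qed (auto simp: sl_def trace_def sum_3 borel_line_def)

declare alg.simps [simp del]

lemma sl_subalgebra_alg:
  "sl_subalgebra (alg U41)" "sl_subalgebra (alg U42)" "sl_subalgebra (alg U43)" "sl_subalgebra (alg U44)"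
  unfolding sl_subalgebra_def
  by (intro conjI subspace_alg; auto simp: alg_U41 alg_U42 alg_U43 alg_U44 sl_def trace_def sum_3
      lie_bracket_def matrix_matrix_mult_def algebra_simps)+

lemma lie_solvable_if_derived_subset:
  assumes "derived_algebra u \<subseteq> v" "lie_solvable v"
  shows "lie_solvable u"
  using assms lie_solvable_subset lie_solvable_if_derived subspace_0 subspace_derived_algebra by blast

lemma lie_solvable_if_brackets:
  assumes "subspace v" "\<And>A B. A \<in> u \<Longrightarrow> B \<in> u \<Longrightarrow> lie_bracket A B \<in> v"
    "\<And>A B. A \<in> v \<Longrightarrow> B \<in> v \<Longrightarrow> lie_bracket A B = 0"
  shows "lie_solvable u"
proof (rule lie_solvable_if_derived_subset[OF derived_algebra_least[OF assms(1,2)]])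
  show "lie_solvable v"
    by (rule lie_solvable_if_derived_subset[OF derived_algebra_least[of "{0}"] lie_solvable_zero])
      (auto simp: assms(3))
qed

text \<open>Brackets are strictly upper triangular; brackets of those lie in the corner entry, where
  everything commutes.\<close>

lemma lie_solvable_borel_line: "lie_solvable (borel_line s t)"
proof -
  let ?n = "{A::real^3^3. A$1$1 = 0 \<and> A$2$1 = 0 \<and> A$2$2 = 0 \<and> A$3$1 = 0 \<and> A$3$2 = 0 \<and> A$3$3 = 0}"
  let ?z = "{A\<in>?n. A$1$2 = 0 \<and> A$2$3 = 0}"
  have "lie_solvable ?n"
    by (rule lie_solvable_if_brackets[of ?z])
      (auto simp: subspace_def lie_bracket_def mat3_simps)
  moreover have "derived_algebra (borel_line s t) \<subseteq> ?n"
    by (rule derived_algebra_least)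
      (auto simp: subspace_def borel_line_def lie_bracket_def matrix_matrix_mult_def sum_3)
  ultimately show ?thesis by (rule lie_solvable_if_derived_subset[rotated])
qed

text \<open>Modulo the abelian space \<open>?row\<close> or \<open>?col\<close> what remains is
  commutative: diagonal matrices for \<open>U41\<close> and \<open>U43\<close>, complex scalars on a
  plane for \<open>U42\<close> and \<open>U44\<close>.\<close>

lemma lie_solvable_alg:
  "lie_solvable (alg U41)" "lie_solvable (alg U42)" "lie_solvable (alg U43)" "lie_solvable (alg U44)"
proof -
  let ?row = "{A::real^3^3. \<forall>i j. A$i$j \<noteq> 0 \<longrightarrow> i = 1 \<and> j \<noteq> 1}"
  let ?col = "{A::real^3^3. \<forall>i j. A$i$j \<noteq> 0 \<longrightarrow> j = 2 \<and> i \<noteq> 2}"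
  show "lie_solvable (alg U41)" "lie_solvable (alg U42)"
    by (rule lie_solvable_if_brackets[of ?row],
        auto simp: alg_U41 alg_U42 subspace_def lie_bracket_def mat3_simps)+
  show "lie_solvable (alg U43)" "lie_solvable (alg U44)"
    by (rule lie_solvable_if_brackets[of ?col],
        auto simp: alg_U43 alg_U44 subspace_def lie_bracket_def mat3_simps)+
qed

section \<open>Non-conjugacy\<close>

text \<open>The union of the invariant lines, in general not a subspace; its \<open>dim\<close> is
  that of its span. Applied to the negative transpose it records the invariant planes.\<close>

definition inv_vectors :: "(real^'n^'n) set \<Rightarrow> (real^'n) set" where
  "inv_vectors u = {v. \<forall>X\<in>u. \<exists>c. X *v v = c *\<^sub>R v}"

lemma inv_vectors_conj:
  assumes g: "invertible g"
  shows "inv_vectors (conj_act g u) = (*v) g ` inv_vectors u"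
proof -
  have 1: "g *v v \<in> inv_vectors (conj_act g u)" if v: "v \<in> inv_vectors u" for v
  proof (unfold inv_vectors_def conj_act_def, intro CollectI ballI)
    fix Y assume "Y \<in> (\<lambda>A. g ** A ** matrix_inv g) ` u"
    then obtain X where X: "X \<in> u" "Y = g ** X ** matrix_inv g" by blast
    then obtain c where "X *v v = c *\<^sub>R v"
      using v by (auto simp: inv_vectors_def)
    then have "Y *v (g *v v) = c *\<^sub>R (g *v v)"
      by (metis X(2) inv_cancel'(1)[OF g] matrix_vector_mul_assoc matrix_vector_mult_scaleR)
    then show "\<exists>c. Y *v (g *v v) = c *\<^sub>R (g *v v)" by blast
  qed
  have 2: "matrix_inv g *v v \<in> inv_vectors u" if v: "v \<in> inv_vectors (conj_act g u)" for v
  proof (unfold inv_vectors_def, intro CollectI ballI)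
    fix X assume "X \<in> u"
    then obtain c where "(g ** X ** matrix_inv g) *v v = c *\<^sub>R v"
      using v by (force simp: inv_vectors_def conj_act_def)
    then have "matrix_inv g *v ((g ** X ** matrix_inv g) *v v) = c *\<^sub>R (matrix_inv g *v v)"
      by (simp add: matrix_vector_mult_scaleR)
    then show "\<exists>c. X *v (matrix_inv g *v v) = c *\<^sub>R (matrix_inv g *v v)"
      by (auto simp: matrix_vector_mul_assoc matrix_mul_assoc inv_cancel[OF g])
  qed
  have "g *v (matrix_inv g *v v) = v" for v
    by (simp add: matrix_vector_mul_assoc inv_cancel[OF g])
  then show ?thesis using 1 2 by (metis (no_types, lifting) image_eqI image_subsetI subsetI subset_antisym)
qed

lemma dim_inv_vectors_SL_conjugate:
  assumes "SL_conjugate u v" shows "dim (inv_vectors u) = dim (inv_vectors v)"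
proof -
  obtain g where g: "invertible g" "v = conj_act g u"
    using assms unfolding SL_conjugate_def SL_def
    by (metis (mono_tags, lifting) invertible_det_nz mem_Collect_eq zero_neq_one)
  have "inj ((*v) g)"
    using g(1) inj_matrix_vector_mult by blast
  then show ?thesis
    unfolding g(2) inv_vectors_conj[OF g(1)]
    by (intro dim_image_eq[symmetric] matrix_vector_mul_linear) (auto intro: inj_on_subset)
qed

lemma dim_inv_covectors_SL_conjugate:
  assumes "SL_conjugate u v"
  shows "dim (inv_vectors (neg_transpose ` u)) = dim (inv_vectors (neg_transpose ` v))"
  using SL_conjugate_neg_transpose[of "neg_transpose ` u" v] assms
  by (intro dim_inv_vectors_SL_conjugate) simp

text \<open>The cross product eliminates the unknown eigenvalue and leaves polynomial equations in
  the coordinates of \<open>v\<close>.\<close>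

lemma inv_vectorsD: "v \<in> inv_vectors u \<Longrightarrow> X \<in> u \<Longrightarrow> cross3 v (X *v v) = 0"
  by (auto simp: inv_vectors_def cross_mult_right)

lemma mem_neg_transpose: "A \<in> neg_transpose ` u \<longleftrightarrow> neg_transpose A \<in> u"
  by (metis image_iff neg_transpose_neg_transpose)

lemma neg_transpose_nth: "neg_transpose A $ i $ j = - A $ j $ i"
  by (simp add: neg_transpose_def transpose_def)

lemmas matvec_simps = matrix_vector_mult_def sum_3 vec_eq_iff forall_3 mat_unit_nth

lemma inv_vectors_borel_line: "inv_vectors (borel_line s t) = {v. v$2 = 0 \<and> v$3 = 0}"
proof safe
  fix v assume v: "v \<in> inv_vectors (borel_line s t)"
  have "mat_unit 1 2 \<in> borel_line s t" "mat_unit 2 3 \<in> borel_line s t"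
    by (auto simp: borel_line_def mat_unit_nth)
  note c = this[THEN inv_vectorsD[OF v]]
  show "v$3 = 0" using c(2) by (auto simp: cross3_def matvec_simps)
  show "v$2 = 0" using c(1) by (auto simp: cross3_def matvec_simps)
next
  fix v :: "real^3" assume "v$2 = 0" "v$3 = 0"
  then show "v \<in> inv_vectors (borel_line s t)"
    by (auto simp: inv_vectors_def borel_line_def matvec_simps intro!: exI[of _ "_$1$1"])
qed

lemma inv_covectors_borel_line: "inv_vectors (neg_transpose ` borel_line s t) = {v. v$1 = 0 \<and> v$2 = 0}"
proof safe
  fix v assume v: "v \<in> inv_vectors (neg_transpose ` borel_line s t)"
  have "mat_unit 2 1 \<in> neg_transpose ` borel_line s t" "mat_unit 3 2 \<in> neg_transpose ` borel_line s t"
    by (auto simp: borel_line_def mat_unit_nth mem_neg_transpose neg_transpose_nth)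
  note c = this[THEN inv_vectorsD[OF v]]
  show "v$1 = 0" using c(1) by (auto simp: cross3_def matvec_simps)
  show "v$2 = 0" using c(2) by (auto simp: cross3_def matvec_simps)
next
  fix v :: "real^3" assume "v$1 = 0" "v$2 = 0"
  then show "v \<in> inv_vectors (neg_transpose ` borel_line s t)"
    by (auto simp: inv_vectors_def borel_line_def matvec_simps neg_transpose_nth intro!: exI[of _ "- _$3$3"])
qed

lemma inv_vectors_U41: "inv_vectors (alg U41) = {v. v$2 = 0 \<and> v$3 = 0}"
proof safe
  fix v assume v: "v \<in> inv_vectors (alg U41)"
  have "mat_unit 1 2 \<in> alg U41" "mat_unit 1 3 \<in> alg U41"
    by (auto simp: alg_U41 mat_unit_nth)
  note c = this[THEN inv_vectorsD[OF v]]
  show "v$3 = 0" using c(2) by (auto simp: cross3_def matvec_simps)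
  show "v$2 = 0" using c(1) by (auto simp: cross3_def matvec_simps)
next
  fix v :: "real^3" assume "v$2 = 0" "v$3 = 0"
  then show "v \<in> inv_vectors (alg U41)"
    by (auto simp: inv_vectors_def alg_U41 matvec_simps intro!: exI[of _ "_$1$1"])
qed

lemma inv_vectors_U42: "inv_vectors (alg U42) = {v. v$2 = 0 \<and> v$3 = 0}"
proof safe
  fix v assume v: "v \<in> inv_vectors (alg U42)"
  have "mat_unit 1 2 \<in> alg U42" "mat_unit 1 3 \<in> alg U42"
    by (auto simp: alg_U42 mat_unit_nth)
  note c = this[THEN inv_vectorsD[OF v]]
  show "v$3 = 0" using c(2) by (auto simp: cross3_def matvec_simps)
  show "v$2 = 0" using c(1) by (auto simp: cross3_def matvec_simps)
next
  fix v :: "real^3" assume "v$2 = 0" "v$3 = 0"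
  then show "v \<in> inv_vectors (alg U42)"
    by (auto simp: inv_vectors_def alg_U42 matvec_simps intro!: exI[of _ "- 2 * _$3$3"])
qed

lemma inv_vectors_U43: "inv_vectors (alg U43) = {v. v$2 = 0 \<and> (v$1 = 0 \<or> v$3 = 0)}"
proof safe
  fix v assume v: "v \<in> inv_vectors (alg U43)"
  have "mat_unit 1 2 \<in> alg U43" "mat_unit 3 2 \<in> alg U43" "mat_unit 1 1 - mat_unit 3 3 \<in> alg U43"
    by (auto simp: alg_U43 mat_unit_nth)
  note c = this[THEN inv_vectorsD[OF v]]
  show "v$2 = 0" using c(1) by (auto simp: cross3_def matvec_simps)
  show "v$1 = 0" if "v$3 \<noteq> 0" using that c(3) by (auto simp: cross3_def matvec_simps)
next
  fix v :: "real^3" assume "v$2 = 0" "v$1 = 0"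
  then show "v \<in> inv_vectors (alg U43)"
    by (auto simp: inv_vectors_def alg_U43 matvec_simps intro!: exI[of _ "_$3$3"])
next
  fix v :: "real^3" assume "v$2 = 0" "v$3 = 0"
  then show "v \<in> inv_vectors (alg U43)"
    by (auto simp: inv_vectors_def alg_U43 matvec_simps intro!: exI[of _ "_$1$1"])
qed

lemma sum_squares_zero: "x * x + y * y = 0 \<Longrightarrow> x = 0 \<and> y = 0" for x y :: real
  by (simp add: sum_squares_eq_zero_iff)

text \<open>\<open>mat_unit 1 2\<close> forces the second coordinate to vanish, and the quarter turn
  in the other two coordinates has no real eigenline.\<close>

lemma inv_vectors_U44: "inv_vectors (alg U44) = {0}"
proof safe
  fix v assume v: "v \<in> inv_vectors (alg U44)"
  have "mat_unit 1 2 \<in> alg U44" "mat_unit 1 3 - mat_unit 3 1 \<in> alg U44"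
    by (auto simp: alg_U44 mat_unit_nth)
  note c = this[THEN inv_vectorsD[OF v]]
  have v2: "v$2 = 0" using c(1) by (auto simp: cross3_def matvec_simps)
  moreover have "v$1 * v$1 + v$3 * v$3 = 0"
    using c(2) v2 by (simp add: cross3_def matvec_simps algebra_simps del: sum_squares_eq_zero_iff)
  then have "v$1 = 0 \<and> v$3 = 0" by (rule sum_squares_zero)
  ultimately show "v = 0" by (simp add: vec_eq_iff forall_3)
qed (auto simp: inv_vectors_def)

lemma inv_covectors_U41: "inv_vectors (neg_transpose ` alg U41) = {v. v$1 = 0 \<and> (v$2 = 0 \<or> v$3 = 0)}"
proof safe
  fix v assume v: "v \<in> inv_vectors (neg_transpose ` alg U41)"
  have "mat_unit 2 1 \<in> neg_transpose ` alg U41" "mat_unit 2 2 - mat_unit 3 3 \<in> neg_transpose ` alg U41"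
    by (auto simp: alg_U41 mat_unit_nth mem_neg_transpose neg_transpose_nth)
  note c = this[THEN inv_vectorsD[OF v]]
  show "v$1 = 0" using c(1) by (auto simp: cross3_def matvec_simps)
  show "v$2 = 0" if "v$3 \<noteq> 0" using that c(2) by (auto simp: cross3_def matvec_simps)
next
  fix v :: "real^3" assume "v$1 = 0" "v$2 = 0"
  then show "v \<in> inv_vectors (neg_transpose ` alg U41)"
    by (auto simp: inv_vectors_def alg_U41 matvec_simps neg_transpose_nth intro!: exI[of _ "- _$3$3"])
next
  fix v :: "real^3" assume "v$1 = 0" "v$3 = 0"
  then show "v \<in> inv_vectors (neg_transpose ` alg U41)"
    by (auto simp: inv_vectors_def alg_U41 matvec_simps neg_transpose_nth intro!: exI[of _ "_$1$1 + _$3$3"])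
qed

lemma inv_covectors_U42: "inv_vectors (neg_transpose ` alg U42) = {0}"
proof safe
  fix v assume v: "v \<in> inv_vectors (neg_transpose ` alg U42)"
  have "mat_unit 2 1 \<in> neg_transpose ` alg U42" "mat_unit 2 3 - mat_unit 3 2 \<in> neg_transpose ` alg U42"
    by (auto simp: alg_U42 mat_unit_nth mem_neg_transpose neg_transpose_nth)
  note c = this[THEN inv_vectorsD[OF v]]
  have v1: "v$1 = 0" using c(1) by (auto simp: cross3_def matvec_simps)
  moreover have "v$2 * v$2 + v$3 * v$3 = 0"
    using c(2) v1 by (simp add: cross3_def matvec_simps algebra_simps del: sum_squares_eq_zero_iff)
  then have "v$2 = 0 \<and> v$3 = 0" by (rule sum_squares_zero)
  ultimately show "v = 0" by (simp add: vec_eq_iff forall_3)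
qed (auto simp: inv_vectors_def)

lemma dim_coordinate_axis:
  "dim {v::real^3. v$2 = 0 \<and> v$3 = 0} = 1" "dim {v::real^3. v$1 = 0 \<and> v$2 = 0} = 1"
proof -
  have "{v::real^3. v$2 = 0 \<and> v$3 = 0} = span {axis 1 1}" "{v::real^3. v$1 = 0 \<and> v$2 = 0} = span {axis 3 1}"
    by (auto simp: span_singleton axis_def vec_eq_iff forall_3)
  then show "dim {v::real^3. v$2 = 0 \<and> v$3 = 0} = 1" "dim {v::real^3. v$1 = 0 \<and> v$2 = 0} = 1"
    by (simp_all add: axis_eq_0_iff)
qed

text \<open>Meant for a union of two coordinate axes, which is not a subspace but spans a coordinate
  plane.\<close>

lemma dim_two_axes:
  assumes "axis i 1 \<in> S" "axis j 1 \<in> S" "i \<noteq> j" "\<And>v k. v \<in> S \<Longrightarrow> k \<noteq> i \<Longrightarrow> k \<noteq> j \<Longrightarrow> v $ k = 0"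
  shows "dim (S :: (real^'n) set) = 2"
proof (rule dim_unique)
  let ?B = "{axis i 1, axis j 1 :: real^'n}"
  show "independent ?B"
    by (rule independent_mono[OF independent_Basis]) (auto simp: axis_in_Basis_iff)
  show "card ?B = 2"
    using assms(3) by (simp add: axis_eq_axis)
  show "S \<subseteq> span ?B"
  proof
    fix v assume "v \<in> S"
    then have "v = v$i *\<^sub>R axis i 1 + v$j *\<^sub>R axis j 1"
      using assms(3,4) by (auto simp: vec_eq_iff axis_def)
    then show "v \<in> span ?B"
      by (rule ssubst) (blast intro: span_add span_scale span_base)
  qed
qed (use assms in auto)

lemma dim_inv_vectors:
  "dim (inv_vectors (borel_line s t)) = 1" "dim (inv_vectors (alg U41)) = 1"
  "dim (inv_vectors (alg U42)) = 1" "dim (inv_vectors (alg U43)) = 2" "dim (inv_vectors (alg U44)) = 0"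
proof -
  show "dim (inv_vectors (alg U43)) = 2"
    by (rule dim_two_axes[of 1 _ 3]) (use exhaust_3 in \<open>force simp: inv_vectors_U43 axis_def\<close>)+
qed (simp_all add: inv_vectors_borel_line inv_vectors_U41 inv_vectors_U42 inv_vectors_U44 dim_coordinate_axis)

text \<open>The algebras with one invariant line, \<open>U41\<close>, \<open>U42\<close> and the
  \<open>borel_line\<close> family, are told apart here by 2, 0 and 1. \<open>U43\<close> and
  \<open>U44\<close> are already isolated by \<open>dim_inv_vectors\<close>.\<close>

lemma dim_inv_covectors:
  "dim (inv_vectors (neg_transpose ` borel_line s t)) = 1"
  "dim (inv_vectors (neg_transpose ` alg U41)) = 2" "dim (inv_vectors (neg_transpose ` alg U42)) = 0"
proof -
  show "dim (inv_vectors (neg_transpose ` alg U41)) = 2"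
    by (rule dim_two_axes[of 2 _ 3]) (use exhaust_3 in \<open>force simp: inv_covectors_U41 axis_def\<close>)+
qed (simp_all add: inv_covectors_borel_line inv_covectors_U42 dim_coordinate_axis)

text \<open>The conjugating matrix preserves the standard flag, hence is triangular, and
  conjugation by it does not change diagonal entries.\<close>

lemma SL_conjugate_borel_lineD:
  assumes "SL_conjugate (borel_line s t) (borel_line s' t')"
  shows "s' * t = t' * s"
proof -
  obtain g where g: "det g = 1" and conj: "borel_line s' t' = conj_act g (borel_line s t)"
    using assms by (auto simp: SL_conjugate_def SL_def)
  then have inv: "invertible g" by (simp add: invertible_det_nz)
  have move: "\<exists>Y\<in>borel_line s' t'. g ** X = Y ** g" if "X \<in> borel_line s t" for X
    using that inv_cancel'[OF inv] unfolding conj conj_act_def by fastforce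
  have "axis 1 1 \<in> inv_vectors (borel_line s t)"
    by (simp add: inv_vectors_borel_line axis_def)
  then have "g *v axis 1 1 \<in> inv_vectors (borel_line s' t')"
    unfolding conj inv_vectors_conj[OF inv] by (rule imageI)
  then have g1: "g$2$1 = 0" "g$3$1 = 0"
    by (simp_all add: inv_vectors_borel_line matrix_vector_mul_component inner_axis)
  have d: "g$1$1 * (g$2$2 * g$3$3 - g$2$3 * g$3$2) = 1"
    using g g1 by (simp add: det_3 algebra_simps)
  \<comment> \<open>The plane of the flag: if \<open>g$3$2\<close> were nonzero, entry (3,2) of the
    relation would force \<open>Y$3$3 = 0\<close>, and entry (3,3) would then give
    \<open>g$3$2 = 0\<close>.\<close>
  have g32: "g$3$2 = 0"
  proof (rule ccontr)
    assume n: "g$3$2 \<noteq> 0"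
    obtain Y where Y: "Y \<in> borel_line s' t'" "g ** mat_unit 2 3 = Y ** g"
      using move[of "mat_unit 2 3"] by (auto simp: borel_line_def mat_unit_nth)
    have e: "(g ** mat_unit 2 3) $ i $ j = (Y ** g) $ i $ j" for i j using Y(2) by simp
    have "Y$3$3 = 0" using e[of 3 2] Y(1) n by (simp add: borel_line_def mat3_simps mat_unit_nth)
    then show False
      using e[of 3 3] Y(1) n by (simp add: borel_line_def mat3_simps mat_unit_nth)
  qed
  \<comment> \<open>The diagonal direction of \<open>borel_line s t\<close>; comparing entries (1,1)
    and (3,3) of \<open>g ** X = Y ** g\<close> transfers its outer diagonal entries to
    \<open>Y\<close>.\<close>
  define X :: "real^3^3" where "X = t *\<^sub>R mat_unit 1 1 - s *\<^sub>R mat_unit 3 3 + (s - t) *\<^sub>R mat_unit 2 2"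
  have "X \<in> borel_line s t"
    by (simp add: X_def borel_line_def mat_unit_nth)
  then obtain Y where Y: "Y \<in> borel_line s' t'" "g ** X = Y ** g"
    using move by blast
  have e: "(g ** X) $ i $ j = (Y ** g) $ i $ j" for i j using Y(2) by simp
  have "g$1$1 \<noteq> 0" "g$3$3 \<noteq> 0" using d g32 by auto
  moreover have "g$1$1 * (Y$1$1 - t) = 0"
    using e[of 1 1] Y(1) g1 by (auto simp: borel_line_def X_def mat3_simps mat_unit_nth)
  moreover have "g$3$3 * (Y$3$3 + s) = 0"
    using e[of 3 3] Y(1) g32
    by (simp add: borel_line_def X_def mat3_simps mat_unit_nth algebra_simps)
  ultimately have "Y$1$1 = t" "Y$3$3 = - s" by auto
  then show ?thesis using Y(1) by (simp add: borel_line_def)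
qed

lemma SL_conjugate_dim: "SL_conjugate u v \<Longrightarrow> dim u = dim v"
  by (auto simp: SL_conjugate_def SL_def dim_conj invertible_det_nz)

text \<open>Dimension isolates \<open>U51\<close>, and the invariant vectors and covectors isolate
  \<open>U41\<close> to \<open>U44\<close>. The other entries are \<open>borel_line\<close> algebras
  with normalised coefficients, for which proportional means equal.\<close>

lemma labels_not_conjugate:
  assumes "e \<in> labels4 \<union> labels5" "f \<in> labels4 \<union> labels5" "e \<noteq> f"
  shows "\<not> SL_conjugate (alg e) (alg f)"
proof
  assume c: "SL_conjugate (alg e) (alg f)"
  note inv = SL_conjugate_dim[OF c] dim_inv_vectors_SL_conjugate[OF c]
    dim_inv_covectors_SL_conjugate[OF c]
  have d: "dim (borel_line 1 x) = 4" "dim (borel_line 0 1) = 4" "dim (borel_line 0 0) = 5" for x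
    using dim_alg_U51 by (simp_all add: dim_borel_line alg_U51)
  show False
    using assms inv c unfolding labels4_def labels5_def
    by (auto simp: alg_borel_line alg_U51 dim_inv_vectors dim_inv_covectors d
        dim_alg_U41 dim_alg_U42 dim_alg_U43 dim_alg_U44 dest!: SL_conjugate_borel_lineD
        simp del: dim_eq_0)
qed

section \<open>Triangular algebras\<close>

lemma SL_conjugate_refl: "SL_conjugate u u" for u :: "(real^3^3) set"
  using SL_conjugate_conj_act[of "mat 1" u] matrix_inv_unique[of "mat 1 :: real^3^3" "mat 1"]
  by (simp add: conj_act_def invertible_det_nz det_I)

lemma borel_line_alg: "\<exists>e\<in>labels4 \<union> labels5. alg e = borel_line s t"
proof -
  consider "s = 0" "t = 0" | "s = 0" "t \<noteq> 0" | "s \<noteq> 0" by blast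
  then show ?thesis
  proof cases
    case 1
    then show ?thesis by (auto simp: labels5_def alg_U51)
  next
    case 2
    then have "borel_line s t = borel_line 0 1" by (auto simp: borel_line_def)
    then show ?thesis by (auto simp: labels4_def alg_borel_line)
  next
    case 3
    then have "s * x + t * y = 0 \<longleftrightarrow> 1 * x + (t / s) * y = 0" for x y :: real
      by (simp add: field_simps)
    then have *: "borel_line s t = borel_line 1 (t / s)" by (simp only: borel_line_def)
    consider "t / s = 1" | "t / s = - 1" | "t / s \<noteq> 1 \<and> t / s \<noteq> - 1" by blast
    then show ?thesis
    proof cases
      case 1
      then show ?thesis unfolding * by (intro bexI[of _ U45]) (simp_all add: labels4_def alg_borel_line)
    next
      case 2
      then show ?thesis unfolding * by (intro bexI[of _ U48]) (simp_all add: labels4_def alg_borel_line)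
    next
      case 3
      then show ?thesis unfolding *
        by (intro bexI[of _ "U46 (t / s)"]) (simp_all add: labels4_def alg_borel_line)
    qed
  qed
qed

text \<open>The coefficients are read off from a normal vector of \<open>u\<close> inside the Borel
  subalgebra, with \<open>A$2$2\<close> eliminated by tracelessness.\<close>

lemma hyperplane_of_borel:
  assumes "subspace u" "u \<subseteq> borel_line 0 0" "dim u = 4"
  obtains p q r s t where "p \<noteq> 0 \<or> q \<noteq> 0 \<or> r \<noteq> 0 \<or> s \<noteq> 0 \<or> t \<noteq> 0"
    "u = {A \<in> borel_line 0 0. p * A$1$2 + q * A$2$3 + r * A$1$3 + s * A$1$1 + t * A$3$3 = 0}"
proof -
  let ?b = "borel_line 0 0"
  have dimb: "dim ?b = 5" using dim_alg_U51 by (simp add: alg_U51)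
  have "u \<subset> ?b" using assms dimb by auto
  then have "span u \<subset> span ?b"
    using assms(1) subspace_borel_line by (metis span_eq_iff)
  then obtain N where N: "N \<noteq> 0" "N \<in> span ?b" "\<And>A. A \<in> span u \<Longrightarrow> orthogonal N A"
    using orthogonal_to_subspace_exists_gen by blast
  let ?V = "{A \<in> ?b. N \<bullet> A = 0}"
  have Nb: "N \<in> ?b" using N(2) subspace_borel_line by (metis span_eq_iff)
  have V: "subspace ?V"
    using subspace_borel_line[of 0 0] by (auto simp: subspace_def inner_add_right)
  have "N \<notin> ?V" using N(1) by simp
  then have "?V \<subset> ?b" using Nb by blast
  then have "dim ?V < dim ?b"
    using V subspace_borel_line[of 0 0] by (intro dim_psubset) (simp only: span_eq_iff[THEN iffD2])
  moreover have "u \<subseteq> ?V"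
    using N(3) assms(2) by (auto simp: orthogonal_def span_base)
  ultimately have u: "u = ?V"
    using assms V dimb by (intro subspace_dim_equal) auto
  let ?s = "N$1$1 - N$2$2" let ?t = "N$3$3 - N$2$2"
  have "N \<bullet> A = N$1$2 * A$1$2 + N$2$3 * A$2$3 + N$1$3 * A$1$3 + ?s * A$1$1 + ?t * A$3$3" if "A \<in> ?b" for A
  proof -
    have "A$2$1 = 0" "A$3$1 = 0" "A$3$2 = 0" "A$2$2 = - A$1$1 - A$3$3"
      using that by (simp_all add: borel_line_def)
    then show ?thesis by (simp add: inner_vec_def sum_3) (simp add: algebra_simps)
  qed
  then have V_eq: "?V = {A \<in> ?b. N$1$2 * A$1$2 + N$2$3 * A$2$3 + N$1$3 * A$1$3 + ?s * A$1$1 + ?t * A$3$3 = 0}"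
    by auto
  \<comment> \<open>If all five coefficients vanish, \<open>N\<close> is diagonal with equal
    entries, and tracelessness makes it zero.\<close>
  have nz: "N$1$2 \<noteq> 0 \<or> N$2$3 \<noteq> 0 \<or> N$1$3 \<noteq> 0 \<or> ?s \<noteq> 0 \<or> ?t \<noteq> 0"
  proof (rule ccontr)
    assume "\<not> ?thesis"
    then have "N = 0" using Nb by (simp add: borel_line_def vec_eq_iff forall_3)
    then show False using N(1) by simp
  qed
  show ?thesis by (rule that[OF nz trans[OF u V_eq]])
qed

text \<open>The form defining \<open>u\<close> must vanish on brackets of elements of its kernel.
  Testing well chosen pairs restricts its coefficients.\<close>

lemma classify_triangular_dim4:
  assumes u: "subspace u" "u \<subseteq> borel_line 0 0" "dim u = 4"
    and closed: "\<And>A B. A \<in> u \<Longrightarrow> B \<in> u \<Longrightarrow> lie_bracket A B \<in> u"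
  shows "\<exists>e\<in>labels4 \<union> labels5. SL_conjugate u (alg e)"
proof -
  obtain p q r s t where nz: "p \<noteq> 0 \<or> q \<noteq> 0 \<or> r \<noteq> 0 \<or> s \<noteq> 0 \<or> t \<noteq> 0" and
    "u = {A \<in> borel_line 0 0. p * A$1$2 + q * A$2$3 + r * A$1$3 + s * A$1$1 + t * A$3$3 = 0}"
    by (rule hyperplane_of_borel[OF u])
  then have mem: "A \<in> u \<longleftrightarrow> A \<in> borel_line 0 0 \<and>
      p * A$1$2 + q * A$2$3 + r * A$1$3 + s * A$1$1 + t * A$3$3 = 0" for A
    by auto
  note simps = mem borel_line_def mat_unit_nth lie_bracket_def matrix_matrix_mult_def sum_3
  \<comment> \<open>The bracket of the two test elements is \<open>r * r\<close> times
    \<open>mat_unit 1 3\<close>, where the form takes the value \<open>r ^ 3\<close>.\<close>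
  have r: "r = 0"
  proof -
    have "r *\<^sub>R mat_unit 1 2 - p *\<^sub>R mat_unit 1 3 \<in> u" "r *\<^sub>R mat_unit 2 3 - q *\<^sub>R mat_unit 1 3 \<in> u"
      by (simp_all add: simps)
    from closed[OF this] show ?thesis by (simp add: simps)
  qed
  \<comment> \<open>The diagonal part of the second element acts on \<open>mat_unit 1 2\<close> and
    \<open>mat_unit 2 3\<close> with opposite eigenvalues, so the form on the bracket is a nonzero
    multiple of \<open>p * p * q\<close>.\<close>
  have pq: "p = 0 \<or> q = 0"
  proof -
    have "q *\<^sub>R mat_unit 1 2 - p *\<^sub>R mat_unit 2 3 \<in> u"
      "p *\<^sub>R mat_unit 1 1 - (2 * p) *\<^sub>R mat_unit 2 2 + p *\<^sub>R mat_unit 3 3 - (s + t) *\<^sub>R mat_unit 1 2 \<in> u"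
      by (simp_all add: simps r algebra_simps)
    from closed[OF this] show ?thesis by (simp add: simps r algebra_simps)
  qed
  consider (line) "p = 0" "q = 0" | (q) "p = 0" "q \<noteq> 0" | (p) "q = 0" "p \<noteq> 0" using pq by blast
  then show ?thesis
  proof cases
    case line
    then have "u = borel_line s t" using r by (auto simp: mem borel_line_def)
    then show ?thesis using borel_line_alg[of s t] SL_conjugate_refl by metis
  next
    case q
    have "q *\<^sub>R mat_unit 1 1 - q *\<^sub>R mat_unit 2 2 - s *\<^sub>R mat_unit 2 3 \<in> u"
      "q *\<^sub>R mat_unit 3 3 - q *\<^sub>R mat_unit 2 2 - t *\<^sub>R mat_unit 2 3 \<in> u"
      using r q by (simp_all add: simps)
    from closed[OF this] have t: "t = 2 * s"
      using r q by (simp add: simps)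
    \<comment> \<open>With \<open>t = 2 * s\<close> the form says
      \<open>A$2$3 = x * (A$2$2 - A$3$3)\<close>, and a unipotent conjugation clears this
      entry.\<close>
    define x where "x = s / q"
    have "SL_conjugate u (alg U41)"
    proof (rule SL_conjugateI[of "mat 1 - x *\<^sub>R mat_unit 2 3" "mat 1 + x *\<^sub>R mat_unit 2 3"])
      show "(mat 1 + x *\<^sub>R mat_unit 2 3) ** A ** (mat 1 - x *\<^sub>R mat_unit 2 3) \<in> alg U41" if "A \<in> u" for A
      proof -
        have A22: "A$2$2 = - A$1$1 - A$3$3" using that by (simp add: simps)
        have "q * A$2$3 = s * (A$2$2 - A$3$3)"
          unfolding A22 using that q r t by (simp add: simps algebra_simps)
        then have "A$2$3 = x * (A$2$2 - A$3$3)" using q by (simp add: x_def field_simps)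
        then show ?thesis
          using that[THEN mem[THEN iffD1, THEN conjunct1]] by (simp add: alg_U41 borel_line_def mat3_simps mat_unit_nth) (simp add: algebra_simps)
      qed
    qed (use u dim_alg_U41 in \<open>simp_all add: subspace_alg mat3_simps mat_unit_nth\<close>)
    then show ?thesis by (auto simp: labels4_def)
  next
    case p
    have "p *\<^sub>R mat_unit 1 1 - p *\<^sub>R mat_unit 2 2 - s *\<^sub>R mat_unit 1 2 \<in> u"
      "p *\<^sub>R mat_unit 3 3 - p *\<^sub>R mat_unit 2 2 - t *\<^sub>R mat_unit 1 2 \<in> u"
      using r p by (simp_all add: simps)
    from closed[OF this] have s: "s = 2 * t"
      using r p by (simp add: simps)
    \<comment> \<open>Here a unipotent conjugation clears entry (1,2), and the permutation
      \<open>?w\<close> then exchanges the last two coordinates.\<close>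
    define x where "x = t / p"
    let ?w = "mat_unit 1 1 + mat_unit 2 3 + mat_unit 3 2 :: real^3^3"
    have "SL_conjugate u (alg U43)"
    proof (rule SL_conjugateI[of "?w + x *\<^sub>R mat_unit 1 3" "?w - x *\<^sub>R mat_unit 1 2"])
      show "(?w - x *\<^sub>R mat_unit 1 2) ** A ** (?w + x *\<^sub>R mat_unit 1 3) \<in> alg U43" if "A \<in> u" for A
      proof -
        have A22: "A$2$2 = - A$1$1 - A$3$3" using that by (simp add: simps)
        have "p * A$1$2 = - t * (A$1$1 - A$2$2)"
          unfolding A22 using that p r s by (simp add: simps algebra_simps)
        then have "A$1$2 = - x * (A$1$1 - A$2$2)" using p by (simp add: x_def field_simps)
        then show ?thesis
          using that[THEN mem[THEN iffD1, THEN conjunct1]] by (simp add: alg_U43 borel_line_def mat3_simps mat_unit_nth) (simp add: algebra_simps)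
      qed
    qed (use u dim_alg_U43 in \<open>simp_all add: subspace_alg mat3_simps mat_unit_nth\<close>)
    then show ?thesis by (auto simp: labels4_def)
  qed
qed

section \<open>Algebras with an invariant line\<close>

lemma classify_triangular:
  assumes u: "sl_subalgebra u" "u \<subseteq> borel_line 0 0" "4 \<le> dim u"
  shows "\<exists>e\<in>labels4 \<union> labels5. SL_conjugate u (alg e)"
proof -
  have dimb: "dim (borel_line 0 0) = 5" using dim_alg_U51 by (simp add: alg_U51)
  have s: "subspace u" using u by (simp add: sl_subalgebra_def)
  have "dim u \<le> 5" using dim_subset[OF u(2)] dimb by simp
  then consider "dim u = 4" | "dim u = 5" using u(3) by linarith
  then show ?thesis
  proof cases
    case 1
    then show ?thesis using u by (intro classify_triangular_dim4) (auto simp: sl_subalgebra_def)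
  next
    case 2
    then have "u = borel_line 0 0"
      using dimb by (intro subspace_dim_equal s subspace_borel_line u(2)) simp
    then show ?thesis using borel_line_alg[of 0 0] SL_conjugate_refl by metis
  qed
qed

text \<open>The quadratic condition says that \<open>(a, b)\<close> is an eigenvector of the lower
  right block of every element of \<open>u\<close>.\<close>

lemma triangularize:
  fixes u :: "(real^3^3) set"
  assumes u: "\<And>A. A \<in> u \<Longrightarrow> A$2$1 = 0 \<and> A$3$1 = 0 \<and> trace A = 0"
    and w: "a \<noteq> 0 \<or> b \<noteq> 0"
    "\<And>A. A \<in> u \<Longrightarrow> A$3$2 * a * a - (A$2$2 - A$3$3) * a * b - A$2$3 * b * b = 0"
  shows "\<exists>v. SL_conjugate u v \<and> v \<subseteq> borel_line 0 0"
proof -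
  define n where "n = a * a + b * b"
  have n: "n \<noteq> 0" using w(1) by (simp add: n_def sum_squares_eq_zero_iff)
  \<comment> \<open>The second column is the common eigenvector \<open>(0, a, b)\<close> of the
    quotient action, and the third is orthogonal to it.\<close>
  let ?h = "mat_unit 1 1 + a *\<^sub>R mat_unit 2 2 - b *\<^sub>R mat_unit 2 3 + b *\<^sub>R mat_unit 3 2 + a *\<^sub>R mat_unit 3 3 :: real^3^3"
  let ?g = "mat_unit 1 1 + (a / n) *\<^sub>R mat_unit 2 2 + (b / n) *\<^sub>R mat_unit 2 3
    - (b / n) *\<^sub>R mat_unit 3 2 + (a / n) *\<^sub>R mat_unit 3 3 :: real^3^3"
  have hg: "?h ** ?g = mat 1"
  proof -
    have "a * a / n + b * b / n = 1" using n by (simp add: n_def flip: add_divide_distrib)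
    then show ?thesis by (simp add: mat3_simps mat_unit_nth)
  qed
  then have g: "invertible ?g" using invertible_left_inverse by blast
  have "?g ** A ** ?h \<in> borel_line 0 0" if "A \<in> u" for A
  proof -
    have "trace (?g ** A ** ?h) = 0"
      using trace_conj[OF g, of A] matrix_inv_unique[OF g hg] u[OF that] by simp
    moreover have "(?g ** A ** ?h) $ 3 $ 2 = (A$3$2 * a * a - (A$2$2 - A$3$3) * a * b - A$2$3 * b * b) / n"
      by (simp add: mat3_simps mat_unit_nth) (simp add: field_simps n)
    moreover have "(?g ** A ** ?h) $ 2 $ 1 = 0" "(?g ** A ** ?h) $ 3 $ 1 = 0"
      using u[OF that] by (simp_all add: mat3_simps mat_unit_nth)
    ultimately show ?thesis
      using w(2)[OF that] by (simp add: borel_line_def trace_def sum_3)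
  qed
  then have "conj_act ?g u \<subseteq> borel_line 0 0"
    by (auto simp: conj_act_def matrix_inv_unique[OF g hg])
  then show ?thesis using SL_conjugate_conj_act[OF g] by blast
qed

text \<open>Acting on the quotient by the invariant line and removing the scalar part gives an element
  \<open>A = (p, q; r, - p)\<close> of \<open>sl\<^sub>2\<close> in an abelian ideal.  Here \<open>A\<^sup>2 = c\<close> and \<open>k\<close> is half the trace of
  \<open>A X\<close>; the equations \<open>[A, [A, X]] = 0\<close> become \<open>c X = k A\<close>.\<close>

lemma sl2_double_bracket_zero:
  fixes p q r x y z :: real
  assumes "q * (r * x - p * z) = r * (p * y - q * x)"
    "2 * p * (p * y - q * x) = q * (q * z - y * r)"
    "2 * p * (r * x - p * z) = r * (q * z - y * r)"
  defines "c \<equiv> p * p + q * r" and "k \<equiv> p * x + (q * z + r * y) / 2"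
  shows "c * x = k * p" "c * y = k * q" "c * z = k * r"
  using assms(1-3) unfolding c_def k_def by (simp_all add: field_simps)

text \<open>If \<open>u\<close> acts on the quotient by scalars, or if \<open>c \<ge> 0\<close>,
  there is a common real eigenvector in the quotient and \<open>u\<close> is triangularizable. If
  \<open>c < 0\<close>, every element acts there as a complex scalar, and the dimension bound forces
  all of \<open>U42\<close>.\<close>

lemma classify_line_standard:
  assumes u: "sl_subalgebra u" "lie_solvable u" "4 \<le> dim u"
    and col: "\<And>A. A \<in> u \<Longrightarrow> A$2$1 = 0 \<and> A$3$1 = 0"
  shows "\<exists>e\<in>labels4 \<union> labels5. SL_conjugate u (alg e)"
proof -
  have su: "subspace u" and tr: "\<And>A. A \<in> u \<Longrightarrow> trace A = 0"
    and closed: "\<And>A B. A \<in> u \<Longrightarrow> B \<in> u \<Longrightarrow> lie_bracket A B \<in> u"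
    using u by (auto simp: sl_subalgebra_def sl_def)
  have triang: ?thesis if ab: "a \<noteq> 0 \<or> b \<noteq> 0"
    "\<And>A. A \<in> u \<Longrightarrow> A$3$2 * a * a - (A$2$2 - A$3$3) * a * b - A$2$3 * b * b = 0" for a b
  proof -
    obtain v where v: "SL_conjugate u v" "v \<subseteq> borel_line 0 0"
      using triangularize[OF _ ab(1), of u] col tr ab(2) by blast
    obtain g where "det g = 1" "v = conj_act g u"
      using v(1) by (auto simp: SL_conjugate_def SL_def)
    then have "sl_subalgebra v"
      using u(1) by (simp add: sl_subalgebra_conj invertible_det_nz)
    then show ?thesis
      using classify_triangular[of v] v u(3) SL_conjugate_dim[OF v(1)] SL_conjugate_trans[OF v(1)] by auto
  qed
  \<comment> \<open>On \<open>u\<close>, lying in \<open>K\<close> means acting as a scalar on the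
    quotient by the invariant line.\<close>
  define K :: "(real^3^3) set" where "K = {A. A$2$2 = A$3$3 \<and> A$2$3 = 0 \<and> A$3$2 = 0}"
  show ?thesis
  proof (cases "u \<subseteq> K")
    case True
    then show ?thesis by (intro triang[of 1 0]) (auto simp: K_def)
  next
    case False
    obtain a where sa: "subspace a" and a: "a \<subseteq> u" "\<not> a \<subseteq> K"
      and ideal: "\<And>A B. A \<in> u \<Longrightarrow> B \<in> a \<Longrightarrow> lie_bracket A B \<in> a"
      and abelian: "\<And>A B. A \<in> a \<Longrightarrow> B \<in> a \<Longrightarrow> lie_bracket A B \<in> K"
      by (rule lie_solvable_obtain_ideal[OF u(2) su closed _ False]) (auto simp: K_def)
    obtain A where A: "A \<in> a" "A \<notin> K" using a(2) by blast
    have Au: "A \<in> u" using A a by blast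
    define p q r where "p = (A$2$2 - A$3$3) / 2" and "q = A$2$3" and "r = A$3$2"
    define c where "c = p * p + q * r"
    define k where "k X = p * ((X$2$2 - X$3$3) / 2) + (q * X$3$2 + r * X$2$3) / 2" for X :: "real^3^3"
    have nz: "p \<noteq> 0 \<or> q \<noteq> 0 \<or> r \<noteq> 0" using A(2) by (auto simp: K_def p_def q_def r_def)
    have X: "c * ((X$2$2 - X$3$3) / 2) = k X * p" "c * X$2$3 = k X * q" "c * X$3$2 = k X * r"
      if "X \<in> u" for X
    proof -
      have "lie_bracket A (lie_bracket X A) \<in> K"
        using A(1) that by (intro abelian ideal)
      then have
        "q * (r * ((X$2$2 - X$3$3) / 2) - p * X$3$2) = r * (p * X$2$3 - q * ((X$2$2 - X$3$3) / 2))"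
        "2 * p * (p * X$2$3 - q * ((X$2$2 - X$3$3) / 2)) = q * (q * X$3$2 - X$2$3 * r)"
        "2 * p * (r * ((X$2$2 - X$3$3) / 2) - p * X$3$2) = r * (q * X$3$2 - X$2$3 * r)"
        using col[OF that] col[OF Au]
        by (simp_all add: K_def lie_bracket_def matrix_matrix_mult_def sum_3 p_def q_def r_def field_simps)
      from sl2_double_bracket_zero[OF this]
      show "c * ((X$2$2 - X$3$3) / 2) = k X * p" "c * X$2$3 = k X * q" "c * X$3$2 = k X * r"
        by (simp_all add: c_def k_def)
    qed
    show ?thesis
    proof (cases "c < 0")
      case False
      show ?thesis
      proof (cases "r = 0")
        case True
        \<comment> \<open>The first coordinate direction of the quotient is an eigenvector of
          \<open>A\<close>; it is shown to be one for all of \<open>u\<close>.\<close>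
        have "X$3$2 = 0" if "X \<in> u" for X
        proof (cases "p = 0")
          case False
          then show ?thesis using X(3)[OF that] True by (simp add: c_def)
        next
          case p: True
          then have "q \<noteq> 0" "k X = 0" using nz True X(2)[OF that] by (auto simp: c_def)
          then show ?thesis using p True by (simp add: k_def)
        qed
        then show ?thesis by (intro triang[of 1 0]) auto
      next
        case r: False
        \<comment> \<open>\<open>(p + s, r)\<close> is the eigenvector of
          \<open>(p, q; r, - p)\<close> with eigenvalue \<open>s\<close>.\<close>
        define s where "s = sqrt c"
        have s: "s * s = p * p + q * r" using False by (simp add: s_def flip: c_def)
        have "X$3$2 * (p + s) * (p + s) - (X$2$2 - X$3$3) * (p + s) * r - X$2$3 * r * r = 0"
          (is "?L = 0") if "X \<in> u" for X
        proof (cases "c = 0")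
          case True
          then have "k X = 0" using X(3)[OF that] r by simp
          moreover have "s = 0" using True by (simp add: s_def)
          moreover have "X$3$2 * p * p - (X$2$2 - X$3$3) * p * r - X$2$3 * r * r = c * X$3$2 - 2 * r * k X"
            by (simp add: k_def c_def field_simps)
          ultimately show ?thesis using True by simp
        next
          case c: False
          have "c * ?L = (c * X$3$2) * (p + s) * (p + s) - 2 * (c * ((X$2$2 - X$3$3) / 2)) * (p + s) * r - (c * X$2$3) * r * r"
            by (simp add: field_simps)
          also have "\<dots> = k X * r * (s * s - (p * p + q * r))"
            unfolding X[OF that] by (simp add: algebra_simps)
          finally show ?thesis using c s by simp
        qed
        then show ?thesis using r by (intro triang[of "p + s" r]) auto
      qed
    next
      case True
      define d where "d = sqrt (- c)"
      have "d * d = - c" using True by (simp add: d_def)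
      then have d: "d \<noteq> 0" "d * d = - (p * p) - q * r"
        using True by (auto simp: c_def)
      have r: "r \<noteq> 0" using True by (auto simp: c_def not_less)
      \<comment> \<open>On the quotient \<open>A / d\<close> has square \<open>- 1\<close>. The last
        two columns are the second basis vector and its image under \<open>A / d\<close>, so in this
        basis \<open>A / d\<close> is a quarter turn.\<close>
      let ?h = "mat_unit 1 1 + mat_unit 2 2 + (p / d) *\<^sub>R mat_unit 2 3 + (r / d) *\<^sub>R mat_unit 3 3 :: real^3^3"
      let ?g = "mat_unit 1 1 + mat_unit 2 2 - (p / r) *\<^sub>R mat_unit 2 3 + (d / r) *\<^sub>R mat_unit 3 3 :: real^3^3"
      have "SL_conjugate u (alg U42)"
      proof (rule SL_conjugateI[of ?h ?g])
        show "?h ** ?g = mat 1" using d r by (simp add: mat3_simps mat_unit_nth)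
        fix B assume B: "B \<in> u"
        define m where "m = k B / c"
        have "B$2$2 - B$3$3 = 2 * m * p" "B$2$3 = m * q" "B$3$2 = m * r"
          using X[OF B] True by (simp_all add: m_def field_simps)
        then have B22: "B$2$2 = B$3$3 + 2 * m * p" and B23: "B$2$3 = m * q" and B32: "B$3$2 = m * r"
          by simp_all
        have B11: "B$1$1 = - 2 * B$3$3 - 2 * m * p"
          using tr[OF B] B22 by (simp add: trace_def sum_3)
        have qr: "q = - (d * d + p * p) / r" using d(2) r by (simp add: field_simps)
        show "?g ** B ** ?h \<in> alg U42"
          using col[OF B] d(1) r
          by (simp add: alg_U42 mat3_simps mat_unit_nth B22 B23 B32 B11 qr) (simp add: field_simps)
      qed (use su u(3) dim_alg_U42 in \<open>simp_all add: subspace_alg\<close>)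
      then show ?thesis by (auto simp: labels4_def)
    qed
  qed
qed

text \<open>An orthogonal matrix whose first column is the normalised \<open>v\<close> moves the
  invariant line to the first coordinate axis.\<close>

lemma classify_line:
  fixes u :: "(real^3^3) set"
  assumes u: "sl_subalgebra u" "lie_solvable u" "4 \<le> dim u"
    and v: "v \<noteq> 0" "\<And>A. A \<in> u \<Longrightarrow> \<exists>c. A *v v = c *\<^sub>R v"
  shows "\<exists>e\<in>labels4 \<union> labels5. SL_conjugate u (alg e)"
proof -
  let ?v = "(1 / norm v) *\<^sub>R v"
  have "norm ?v = 1" using v(1) by simp
  then obtain Q where Q: "orthogonal_matrix Q" "Q *v axis 1 1 = ?v"
    by (rule orthogonal_matrix_exists_basis)
  let ?g = "transpose Q"
  have QQ: "?g ** Q = mat 1" "Q ** ?g = mat 1" using Q(1) by (auto simp: orthogonal_matrix_def)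
  then have g: "invertible ?g" using invertible_def by blast
  define w where "w = conj_act ?g u"
  have "B$2$1 = 0 \<and> B$3$1 = 0" if "B \<in> w" for B
  proof -
    obtain A where A: "A \<in> u" "B = ?g ** A ** Q"
      using \<open>B \<in> w\<close> by (auto simp: w_def conj_act_def matrix_inv_unique[OF g QQ(2)])
    obtain c where c: "A *v v = c *\<^sub>R v" using v(2)[OF A(1)] by blast
    have "B *v axis 1 1 = ?g *v (A *v (Q *v axis 1 1))"
      by (simp only: A(2) matrix_vector_mul_assoc matrix_mul_assoc)
    also have "\<dots> = ?g *v (c *\<^sub>R (Q *v axis 1 1))"
      unfolding Q(2) by (simp add: matrix_vector_mult_scaleR c)
    also have "\<dots> = c *\<^sub>R axis 1 1"
      by (simp only: matrix_vector_mult_scaleR matrix_vector_mul_assoc QQ(1) matrix_vector_mul_lid)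
    finally have "column 1 B = c *\<^sub>R axis 1 1" by (simp add: matrix_vector_mult_basis)
    then show ?thesis by (auto simp: column_def vec_eq_iff axis_def forall_3)
  qed
  moreover have "sl_subalgebra w" "lie_solvable w" "dim w = dim u"
    unfolding w_def using u g by (simp_all add: sl_subalgebra_conj lie_solvable_conj dim_conj)
  ultimately obtain e where "e \<in> labels4 \<union> labels5" "SL_conjugate w (alg e)"
    using classify_line_standard[of w] u(3) by auto
  then show ?thesis
    using SL_conjugate_trans[OF SL_conjugate_conj_act[OF g, of u]] unfolding w_def by blast
qed

section \<open>Duality and the general case\<close>

lemma neg_transpose_alg:
  assumes "e \<in> labels4 \<union> labels5"
  shows "\<exists>f\<in>labels4 \<union> labels5. SL_conjugate (neg_transpose ` alg e) (alg f)"
proof -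
  \<comment> \<open>Duality pairs \<open>U41\<close> with \<open>U43\<close> and \<open>U42\<close>
    with \<open>U44\<close> after exchanging the first two coordinates. Reversing the coordinates by
    \<open>?m\<close> restores upper triangular form and exchanges \<open>s\<close> and
    \<open>t\<close>.\<close>
  let ?w = "mat_unit 1 2 + mat_unit 2 1 + mat_unit 3 3 :: real^3^3"
  let ?m = "mat_unit 1 3 + mat_unit 2 2 + mat_unit 3 1 :: real^3^3"
  have sub: "subspace (neg_transpose ` u)" if "subspace u" for u :: "(real^3^3) set"
    using that by (intro linear_subspace_image linear_neg_transpose)
  have w: "?w ** ?w = mat 1" and m: "?m ** ?m = mat 1"
    by (simp_all add: mat3_simps mat_unit_nth)
  note simps = neg_transpose_nth mat_unit_nth matrix_matrix_mult_def sum_3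
  have swap: "SL_conjugate (neg_transpose ` alg e) (alg f)"
    if "dim (alg f) \<le> dim (alg e)" "\<And>A. neg_transpose A \<in> alg e \<Longrightarrow> ?w ** A ** ?w \<in> alg f" for e f
    by (rule SL_conjugateI[OF w sub[OF subspace_alg] subspace_alg])
      (use that in \<open>simp_all only: dim_neg_transpose mem_neg_transpose\<close>)
  have "SL_conjugate (neg_transpose ` alg U41) (alg U43)" "SL_conjugate (neg_transpose ` alg U43) (alg U41)"
    by (rule swap, simp add: dim_alg_U41 dim_alg_U43, simp add: simps alg_U41 alg_U43)+
  moreover have "SL_conjugate (neg_transpose ` alg U42) (alg U44)" "SL_conjugate (neg_transpose ` alg U44) (alg U42)"
    by (rule swap, simp add: dim_alg_U42 dim_alg_U44, simp add: simps alg_U42 alg_U44)+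
  moreover have "SL_conjugate (neg_transpose ` borel_line s t) (borel_line t s)" for s t
  proof (rule SL_conjugateI[OF m sub[OF subspace_borel_line] subspace_borel_line])
    have "borel_line 0 0 = alg U51" by (simp add: alg_U51)
    then show "dim (borel_line t s) \<le> dim (neg_transpose ` borel_line s t)"
      by (cases "s = 0 \<and> t = 0") (auto simp: dim_neg_transpose dim_borel_line)
  qed (simp add: simps mem_neg_transpose borel_line_def)
  moreover have "e \<in> {U41, U42, U43, U44} \<or> (\<exists>s t. alg e = borel_line s t)"
    using assms unfolding labels4_def labels5_def using alg_borel_line alg_U51 by blast
  ultimately show ?thesis using borel_line_alg unfolding labels4_def labels5_def by auto metis
qed

lemma classify:
  assumes u: "sl_subalgebra u" "lie_solvable u" "4 \<le> dim u"
  shows "\<exists>e\<in>labels4 \<union> labels5. SL_conjugate u (alg e)"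
proof -
  have "\<not> u \<subseteq> {0}" using u(3) by (metis dim_eq_0 not_numeral_le_zero)
  from solvable_invariant_line_or_plane[OF u(1,2) this] show ?thesis
  proof (elim disjE exE conjE)
    fix v assume "v \<noteq> 0" "\<forall>X\<in>u. \<exists>c. X *v v = c *\<^sub>R v"
    then show ?thesis using classify_line[OF u] by blast
  next
    fix w assume w: "w \<noteq> 0" "\<forall>X\<in>u. \<exists>c. w v* X = c *\<^sub>R w"
    have "\<exists>c. B *v w = c *\<^sub>R w" if B: "B \<in> neg_transpose ` u" for B
    proof -
      obtain X where X: "X \<in> u" "B = - transpose X" using B by (auto simp: neg_transpose_def)
      obtain c where "w v* X = c *\<^sub>R w" using w(2) X(1) by blast
      then have "B *v w = (- c) *\<^sub>R w"
        using matrix_vector_mult_diff_rdistrib[of 0 "transpose X" w] X(2) by simp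
      then show ?thesis by blast
    qed
    moreover have "sl_subalgebra (neg_transpose ` u)" "lie_solvable (neg_transpose ` u)"
      using u by (auto intro!: sl_subalgebra_image lie_solvable_image linear_neg_transpose
          simp: lie_bracket_neg_transpose trace_neg_transpose)
    ultimately obtain e where e: "e \<in> labels4 \<union> labels5" "SL_conjugate (neg_transpose ` u) (alg e)"
      using classify_line[of "neg_transpose ` u" w] u(3) w(1) by (auto simp: dim_neg_transpose)
    then show ?thesis
      using SL_conjugate_neg_transpose neg_transpose_alg SL_conjugate_trans by metis
  qed
qed

lemma labels4_alg:
  assumes "e \<in> labels4" shows "sl_subalgebra (alg e) \<and> lie_solvable (alg e) \<and> dim (alg e) = 4"
  using assms unfolding labels4_def
  by (auto simp: sl_subalgebra_alg lie_solvable_alg dim_alg_U41 dim_alg_U42 dim_alg_U43 dim_alg_U44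
      alg_borel_line sl_subalgebra_borel_line lie_solvable_borel_line dim_borel_line)

lemma labels5_alg:
  assumes "e \<in> labels5" shows "sl_subalgebra (alg e) \<and> lie_solvable (alg e) \<and> dim (alg e) = 5"
  using assms dim_alg_U51 unfolding labels5_def
  by (auto simp: alg_U51 sl_subalgebra_borel_line lie_solvable_borel_line)

theorem theorem5p5:
  shows "(\<forall>e\<in>labels4. sl_subalgebra (alg e) \<and> lie_solvable (alg e) \<and> dim (alg e) = 4)
    \<and> (\<forall>e\<in>labels5. sl_subalgebra (alg e) \<and> lie_solvable (alg e) \<and> dim (alg e) = 5)
    \<and> (\<forall>u :: (real^3^3) set. sl_subalgebra u \<and> lie_solvable u \<and> dim u = 4
          \<longrightarrow> (\<exists>e\<in>labels4. SL_conjugate u (alg e)))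
    \<and> (\<forall>u :: (real^3^3) set. sl_subalgebra u \<and> lie_solvable u \<and> dim u = 5
          \<longrightarrow> (\<exists>e\<in>labels5. SL_conjugate u (alg e)))
    \<and> (\<forall>e\<in>labels4 \<union> labels5. \<forall>f\<in>labels4 \<union> labels5.
          e \<noteq> f \<longrightarrow> \<not> SL_conjugate (alg e) (alg f))
    \<and> (\<forall>a b :: real. a \<noteq> 1 \<and> a \<noteq> - 1 \<and> b \<noteq> 1 \<and> b \<noteq> - 1
          \<longrightarrow> (SL_conjugate (alg (U46 a)) (alg (U46 b)) \<longleftrightarrow> a = b))"
proof (intro conjI)
  show "\<forall>u :: (real^3^3) set. sl_subalgebra u \<and> lie_solvable u \<and> dim u = 4
          \<longrightarrow> (\<exists>e\<in>labels4. SL_conjugate u (alg e))"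
  proof (intro allI impI)
    fix u :: "(real^3^3) set" assume u: "sl_subalgebra u \<and> lie_solvable u \<and> dim u = 4"
    then obtain e where "e \<in> labels4 \<union> labels5" "SL_conjugate u (alg e)" using classify[of u] by auto
    then show "\<exists>e\<in>labels4. SL_conjugate u (alg e)"
      \<comment> \<open>Conjugate algebras have equal dimension, which excludes the five-dimensional
        label.\<close>
      using u SL_conjugate_dim[of u "alg e"] labels5_alg[of e] by auto
  qed
  show "\<forall>u :: (real^3^3) set. sl_subalgebra u \<and> lie_solvable u \<and> dim u = 5
          \<longrightarrow> (\<exists>e\<in>labels5. SL_conjugate u (alg e))"
  proof (intro allI impI)
    fix u :: "(real^3^3) set" assume u: "sl_subalgebra u \<and> lie_solvable u \<and> dim u = 5"
    then obtain e where "e \<in> labels4 \<union> labels5" "SL_conjugate u (alg e)" using classify[of u] by auto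
    then show "\<exists>e\<in>labels5. SL_conjugate u (alg e)"
      using u SL_conjugate_dim[of u "alg e"] labels4_alg[of e] by auto
  qed
  show "\<forall>a b :: real. a \<noteq> 1 \<and> a \<noteq> - 1 \<and> b \<noteq> 1 \<and> b \<noteq> - 1
          \<longrightarrow> (SL_conjugate (alg (U46 a)) (alg (U46 b)) \<longleftrightarrow> a = b)"
    using SL_conjugate_refl SL_conjugate_borel_lineD[of 1 _ 1] by (auto simp: alg_borel_line)
qed (use labels4_alg labels5_alg labels_not_conjugate in blast)+

end
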